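(* For every integer $n\ge 1$ we have \[c_1(n)\equiv c_2(n)\equiv c_4(n)\equiv c_8(n)\equiv c_{16}(n)\pmod 2.\] Moreover: (1) If $n\ge1$ and $n\not\equiv 7\pmod 8$, then $c_1(n)\equiv 0\pmod 2$. (2) For every $n\ge 1$, $c_1(8n-1)\equiv c_{\mu_2}(n)\equiv c_{U_0}(n)\pmod 2$. (3) For every $n\ge 1$, $c_1(16n-1)\equiv c_{S_0}(n)\pmod 2$. (4) For every $n\ge 0$, $c_1(16n+7)\equiv c_{S_1}(n)\pmod 2$.
   Context: Let $q=e^{2\pi i\tau}$ with $\tau$ in the upper half-plane. Write $(a;q)_n=(a,q)_n=\prod_{k=0}^{n-1}(1-aq^k)$, $(q)_n=(q,q)_n$, and $(a,q)_\infty$, $(q)_\infty$ for the infinite products. Let $\eta(\tau)=q^{1/24}(q)_\infty$ and $\eta_k=\eta(k\tau)=q^{k/24}(q^k)_\infty$. Let $j(\tau)=E_4(\tau)^3/\Delta(\tau)$ be the elliptic modular $j$-function, where $E_4=1+240\sum_{n\ge1}\sigma_3(n)q^n$ and $\Delta=q\prod_{n\ge1}(1-q^n)^{24}$. Define the hauptmoduln $j_1=j$, $j_2=\eta_1^{24}/\eta_2^{24}$, $j_4=\eta_1^{8}/\eta_4^{8}$, $j_8=\eta_1^4\eta_4^2/(\eta_2^2\eta_8^4)$, $j_{16}=\eta_1^2\eta_8/(\eta_2\eta_{16}^2)$. Each has an expansion $j_N(\tau)=q^{-1}+a_N+\sum_{n\ge1}c_N(n)q^n$; $c_N(n)$ denotes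 the $n$-th Fourier coefficient. For a $q$-series $f(q)$, $c_f(n)$ denotes the coefficient of $q^n$ in $f$. The mock theta functions are $\mu_2(q)=\sum_{n\ge0}\frac{(-1)^nq^{n^2}(q,q^2)_n}{(-q^2,q^2)_n^2}$ (2nd order), $U_0(q)=\sum_{n\ge0}\frac{q^{n^2}(-q,q^2)_n}{(-q^4,q^4)_n}$, $S_0(q)=\sum_{n\ge0}\frac{q^{n^2}(-q,q^2)_n}{(-q^2,q^2)_n}$, $S_1(q)=\sum_{n\ge0}\frac{q^{n(n+2)}(-q,q^2)_n}{(-q^2,q^2)_n}$ (8th order). *)

theory Defs
  imports
    "HOL-Complex_Analysis.Complex_Analysis"
    "HOL-Number_Theory.Cong"
begin

definition nome :: "complex \<Rightarrow> complex" where
  "nome \<tau> = exp (2 * of_real pi * \<i> * \<tau>)"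

text \<open>
  Polymorphic, so that it can be used both for complex numbers and for formal power series.
\<close>
definition qpoch :: "'a::comm_ring_1 \<Rightarrow> 'a \<Rightarrow> nat \<Rightarrow> 'a" where
  "qpoch a q n = (\<Prod>k<n. 1 - a * q ^ k)"

definition qpoch_inf :: "complex \<Rightarrow> complex \<Rightarrow> complex" where
  "qpoch_inf a q = (\<Prod>k. 1 - a * q ^ k)"

text \<open>
  The factor \<open>q\<^bsup>1/24\<^esup>\<close> is the branch \<open>exp (2 \<pi> \<i> \<tau> / 24)\<close>.
\<close>
definition eta :: "complex \<Rightarrow> complex" where
  "eta \<tau> = exp (2 * of_real pi * \<i> * \<tau> / 24) * qpoch_inf (nome \<tau>) (nome \<tau>)"

definition eta_mult :: "nat \<Rightarrow> complex \<Rightarrow> complex" where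
  "eta_mult k \<tau> = eta (of_nat k * \<tau>)"

definition divisor_sum :: "nat \<Rightarrow> nat \<Rightarrow> nat" where
  "divisor_sum k n = (\<Sum>d | d dvd n. d ^ k)"

definition Eisenstein_E4 :: "complex \<Rightarrow> complex" where
  "Eisenstein_E4 \<tau> =
     1 + 240 * (\<Sum>n. of_nat (divisor_sum 3 (Suc n)) * nome \<tau> ^ Suc n)"

definition modular_discr :: "complex \<Rightarrow> complex" where
  "modular_discr \<tau> = nome \<tau> * (\<Prod>n. (1 - nome \<tau> ^ Suc n) ^ 24)"

definition j1 :: "complex \<Rightarrow> complex" where
  "j1 \<tau> = Eisenstein_E4 \<tau> ^ 3 / modular_discr \<tau>"

definition j2 :: "complex \<Rightarrow> complex" where
  "j2 \<tau> = eta_mult 1 \<tau> ^ 24 / eta_mult 2 \<tau> ^ 24"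

definition j4 :: "complex \<Rightarrow> complex" where
  "j4 \<tau> = eta_mult 1 \<tau> ^ 8 / eta_mult 4 \<tau> ^ 8"

definition j8 :: "complex \<Rightarrow> complex" where
  "j8 \<tau> = eta_mult 1 \<tau> ^ 4 * eta_mult 4 \<tau> ^ 2 / (eta_mult 2 \<tau> ^ 2 * eta_mult 8 \<tau> ^ 4)"

definition j16 :: "complex \<Rightarrow> complex" where
  "j16 \<tau> = eta_mult 1 \<tau> ^ 2 * eta_mult 8 \<tau> / (eta_mult 2 \<tau> * eta_mult 16 \<tau> ^ 2)"

text \<open>
  \<open>F\<close> is the expansion of \<open>f\<close> in powers of \<open>q\<close> (with finitely many negative exponents), and
  this expansion is valid on the whole upper half-plane, i.e. for \<open>0 < \<bar>q\<bar> < 1\<close>.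
\<close>
definition has_q_expansion :: "(complex \<Rightarrow> complex) \<Rightarrow> complex fls \<Rightarrow> bool" where
  "has_q_expansion f F \<longleftrightarrow>
     fls_conv_radius F \<ge> 1 \<and> (\<forall>\<tau>. Im \<tau> > 0 \<longrightarrow> eval_fls F (nome \<tau>) = f \<tau>)"

definition fourier_coeff :: "(complex \<Rightarrow> complex) \<Rightarrow> int \<Rightarrow> complex" where
  "fourier_coeff f n = fls_nth (THE F. has_q_expansion f F) n"

text \<open>
  The mock theta functions as formal power series in \<open>q\<close>, which is \<open>fps_X\<close>; the series are taken
  in the \<open>q\<close>-adic topology. All denominators have constant coefficient \<open>1\<close>, so that the
  quotients are genuine ones.
\<close>
definition mock_mu2 :: "complex fps" where
  "mock_mu2 = (let q = fps_X in
     \<Sum>n. (-1) ^ n * q ^ (n ^ 2) * qpoch q (q ^ 2) n / qpoch (- (q ^ 2)) (q ^ 2) n ^ 2)"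

definition mock_U0 :: "complex fps" where
  "mock_U0 = (let q = fps_X in
     \<Sum>n. q ^ (n ^ 2) * qpoch (- q) (q ^ 2) n / qpoch (- (q ^ 4)) (q ^ 4) n)"

definition mock_S0 :: "complex fps" where
  "mock_S0 = (let q = fps_X in
     \<Sum>n. q ^ (n ^ 2) * qpoch (- q) (q ^ 2) n / qpoch (- (q ^ 2)) (q ^ 2) n)"

definition mock_S1 :: "complex fps" where
  "mock_S1 = (let q = fps_X in
     \<Sum>n. q ^ (n * (n + 2)) * qpoch (- q) (q ^ 2) n / qpoch (- (q ^ 2)) (q ^ 2) n)"

text \<open>
  Congruence of complex numbers that are rational integers; integrality of both sides is part of
  the claim. The library's \<open>cong\<close> on a field would be trivial.
\<close>
definition icong :: "complex \<Rightarrow> complex \<Rightarrow> int \<Rightarrow> bool" where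
  "icong x y m \<longleftrightarrow> (\<exists>a b :: int. x = of_int a \<and> y = of_int b \<and> [a = b] (mod m))"

lemma nome_surj:
  assumes "z \<noteq> 0" "norm z < 1"
  obtains \<tau> where "Im \<tau> > 0" "nome \<tau> = z"
proof
  let ?\<tau> = "Ln z / (2 * of_real pi * \<i>)"
  show "nome ?\<tau> = z"
    using assms by (simp add: nome_def)
  have "Im ?\<tau> = - ln (norm z) / (2 * pi)"
    using assms by (simp add: Im_divide power2_eq_square)
  also have "\<dots> > 0"
    using assms by (intro divide_pos_pos) auto
  finally show "Im ?\<tau> > 0" .
qed

lemma has_q_expansion_unique:
  assumes "has_q_expansion f F" "has_q_expansion f G"
  shows   "F = G"
proof -
  have F: "eval_fls F has_laurent_expansion F" and G: "eval_fls G has_laurent_expansion G"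
    using assms less_le_trans[of 0 "1::ereal"]
    by (auto simp: has_q_expansion_def has_laurent_expansion_def)
  have "eventually (\<lambda>z::complex. z \<in> ball 0 1 - {0}) (at 0)"
    by (intro eventually_at_in_open) auto
  hence "eventually (\<lambda>z. eval_fls F z = eval_fls G z) (at 0)"
  proof eventually_elim
    case (elim z)
    then obtain \<tau> where "Im \<tau> > 0" "nome \<tau> = z"
      using nome_surj[of z] by auto
    thus ?case
      using assms by (auto simp: has_q_expansion_def)
  qed
  hence "eval_fls F has_laurent_expansion G"
    using G has_laurent_expansion_cong[of "eval_fls F" "eval_fls G" G G] by blast
  with F show ?thesis
    by (rule has_laurent_expansion_unique)
qed

lemma fourier_coeff_eqI:
  assumes "has_q_expansion f F"
  shows   "fourier_coeff f n = fls_nth F n"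
proof -
  have "(THE F. has_q_expansion f F) = F"
    using assms has_q_expansion_unique[OF _ assms] by (rule the_equality)
  thus ?thesis
    by (simp only: fourier_coeff_def)
qed

end

theory Submission
  imports Defs "HOL-Library.Z2" "HOL-Real_Asymp.Real_Asymp"
begin

text \<open>
  Write \<open>f\<^sub>k = (q\<^sup>k; q\<^sup>k)\<^sub>\<infinity>\<close>. Modulo 2 one has \<open>E\<^sub>4 = 1\<close> and \<open>f\<^sub>k\<^sup>2 = f\<^sub>2\<^sub>k\<close>, so each of the five functions becomes
  \<open>q\<^sup>-\<^sup>1 f\<^sub>1\<^bsup>-24\<^esup> = q\<^sup>-\<^sup>1 g(q\<^sup>8)\<close> with \<open>g = 1 / f\<^sub>1\<^sup>3\<close>, which is also \<open>f\<^sub>1 / f\<^sub>2\<^sup>2\<close> modulo 2.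
  The latter quotient has two \<open>q\<close>-hypergeometric expansions: a limit of the \<open>q\<close>-Gauss sum, which reduces to \<open>\<mu>\<^sub>2\<close> and
  to \<open>U\<^sub>0\<close>, and a limit of the very-well-poised \<open>\<^sub>6\<phi>\<^sub>5\<close> sum, which by the Frobenius map reduces to
  \<open>S\<^sub>0(q)\<^sup>2 + q S\<^sub>1(q)\<^sup>2 = S\<^sub>0(q\<^sup>2) + q S\<^sub>1(q\<^sup>2)\<close> and so separates even and odd exponents.
  Both summation formulas follow by telescoping: multiplying both parameters by the base \<open>p = q\<^sup>2\<close> changes the
  sum by an explicit factor, and iterating the shift drives the sum to 1.
\<close>

section \<open>Convergence of formal power series\<close>

text \<open>Convergence of power series means that each coefficient is eventually constant, and
  coefficient n of a sum or product involves only finitely many coefficients of the operands. An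
  arbitrary commutative ring is allowed, so the limit rules serve both \<open>complex\<close> and
  \<open>bit\<close>.\<close>

lemma tendsto_add_fps:
  fixes f g :: "'b \<Rightarrow> 'a::comm_ring_1 fps"
  assumes "(f \<longlongrightarrow> F) A" "(g \<longlongrightarrow> G) A"
  shows   "((\<lambda>x. f x + g x) \<longlongrightarrow> F + G) A"
proof (rule tendsto_fpsI)
  fix n
  show "eventually (\<lambda>x. fps_nth (f x + g x) n = fps_nth (F + G) n) A"
    using assms[unfolded tendsto_fps_iff, rule_format, of n] by eventually_elim simp
qed

lemma tendsto_mult_fps:
  fixes f g :: "'b \<Rightarrow> 'a::comm_ring_1 fps"
  assumes "(f \<longlongrightarrow> F) A" "(g \<longlongrightarrow> G) A"
  shows   "((\<lambda>x. f x * g x) \<longlongrightarrow> F * G) A"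
proof (rule tendsto_fpsI)
  fix n
  have "eventually (\<lambda>x. \<forall>k\<in>{..n}. fps_nth (f x) k = fps_nth F k) A"
       "eventually (\<lambda>x. \<forall>k\<in>{..n}. fps_nth (g x) k = fps_nth G k) A"
    using assms by (auto simp: tendsto_fps_iff intro!: eventually_ball_finite)
  thus "eventually (\<lambda>x. fps_nth (f x * g x) n = fps_nth (F * G) n) A"
    by eventually_elim (auto simp: fps_mult_nth intro!: sum.cong)
qed

lemma tendsto_power_fps:
  fixes f :: "'b \<Rightarrow> 'a::comm_ring_1 fps"
  assumes "(f \<longlongrightarrow> F) A"
  shows   "((\<lambda>x. f x ^ n) \<longlongrightarrow> F ^ n) A"
  by (induction n) (auto intro: tendsto_mult_fps assms)

lemma fps_X_power_dvd_iff:
  fixes f :: "'a::comm_ring_1 fps"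
  shows "fps_X ^ n dvd f \<longleftrightarrow> (\<forall>k<n. fps_nth f k = 0)"
proof
  assume "\<forall>k<n. fps_nth f k = 0"
  hence "f = fps_X ^ n * fps_shift n f"
    by (auto simp: fps_eq_iff fps_X_power_mult_nth)
  thus "fps_X ^ n dvd f"
    by (rule dvdI)
qed (auto simp: fps_X_power_mult_nth elim!: dvdE)

lemma tendsto_0_fpsI:
  fixes f :: "nat \<Rightarrow> 'a::comm_ring_1 fps"
  assumes "\<And>n. fps_X ^ n dvd f n"
  shows   "f \<longlonglongrightarrow> 0"
proof (rule tendsto_fpsI)
  fix n
  show "eventually (\<lambda>N. fps_nth (f N) n = fps_nth 0 n) sequentially"
    using eventually_gt_at_top[of n] by eventually_elim (use assms in \<open>auto simp: fps_X_power_dvd_iff\<close>)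
qed

text \<open>A term with index above k is divisible by \<open>fps_X ^ (k + 1)\<close> and cannot
  reach coefficient k.\<close>

lemma fps_nth_sum_stabilises:
  fixes t :: "nat \<Rightarrow> 'a::comm_ring_1 fps"
  assumes "\<And>n. fps_X ^ n dvd t n" "k < N"
  shows   "fps_nth (\<Sum>n<N. t n) k = (\<Sum>n\<le>k. fps_nth (t n) k)"
proof -
  have "fps_nth (\<Sum>n<N. t n) k = (\<Sum>n<N. fps_nth (t n) k)"
    by (simp add: fps_sum_nth)
  also have "\<dots> = (\<Sum>n\<le>k. fps_nth (t n) k)"
    using assms by (intro sum.mono_neutral_right) (auto simp: fps_X_power_dvd_iff)
  finally show ?thesis .
qed

lemma sums_fps:
  fixes t :: "nat \<Rightarrow> 'a::comm_ring_1 fps"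
  assumes "\<And>n. fps_X ^ n dvd t n"
  shows   "t sums Abs_fps (\<lambda>k. \<Sum>n\<le>k. fps_nth (t n) k)"
  unfolding sums_def
proof (rule tendsto_fpsI)
  fix k
  show "eventually (\<lambda>N. fps_nth (\<Sum>n<N. t n) k =
          fps_nth (Abs_fps (\<lambda>k. \<Sum>n\<le>k. fps_nth (t n) k)) k) sequentially"
    using eventually_gt_at_top[of k]
    by eventually_elim (use assms in \<open>simp add: fps_nth_sum_stabilises\<close>)
qed

lemma suminf_fps_sums:
  fixes t :: "nat \<Rightarrow> 'a::comm_ring_1 fps"
  assumes "\<And>n. fps_X ^ n dvd t n"
  shows   "t sums suminf t"
  using sums_fps[OF assms] by (simp add: sums_iff)

lemma fps_nth_suminf:
  fixes t :: "nat \<Rightarrow> 'a::comm_ring_1 fps"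
  assumes "\<And>n. fps_X ^ n dvd t n"
  shows   "fps_nth (suminf t) k = (\<Sum>n\<le>k. fps_nth (t n) k)"
  using sums_unique[OF sums_fps[OF assms]] by (metis fps_nth_Abs_fps)

section \<open>Finite q-products and formal Euler products\<close>

lemma qpoch_0 [simp]: "qpoch a q 0 = 1"
  by (simp add: qpoch_def)

lemma qpoch_Suc: "qpoch a q (Suc n) = qpoch a q n * (1 - a * q ^ n)"
  by (simp add: qpoch_def)

lemma qpoch_Suc_shift: "qpoch a q (Suc n) = (1 - a) * qpoch (a * q) q n"
  unfolding qpoch_def by (subst prod.lessThan_Suc_shift) (simp add: mult_ac)

lemma fps_nth_0_qpoch [simp]:
  fixes a q :: "'a::comm_ring_1 fps"
  assumes "fps_nth a 0 = 0"
  shows   "fps_nth (qpoch a q n) 0 = 1"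
  by (induction n) (use assms in \<open>auto simp: qpoch_Suc fps_mult_nth_0\<close>)

text \<open>The formal product f_k = (q^k; q^k)_inf for k > 0. The diagonal coefficient is already
  final: every factor beyond the n-th is 1 modulo q^(n+1).\<close>

definition euler_fps :: "nat \<Rightarrow> 'a::comm_ring_1 fps" where
  "euler_fps k = Abs_fps (\<lambda>n. fps_nth (qpoch (fps_X ^ k) (fps_X ^ k) n) n)"

lemma qpoch_tendsto_euler_fps:
  assumes "k > 0"
  shows   "qpoch (fps_X ^ k) (fps_X ^ k) \<longlonglongrightarrow> (euler_fps k :: 'a::comm_ring_1 fps)"
proof (rule tendsto_fpsI)
  fix n
  define Q :: "nat \<Rightarrow> 'a fps" where "Q = qpoch (fps_X ^ k) (fps_X ^ k)"
  have "fps_nth (Q (n + d)) n = fps_nth (Q n) n" for d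
  proof (induction d)
    case (Suc d)
    have "fps_X ^ (k * Suc (n + d)) = fps_X ^ k * (fps_X ^ k :: 'a fps) ^ (n + d)"
      by (simp only: power_mult power_Suc)
    hence "Q (n + Suc d) = Q (n + d) - fps_X ^ (k * Suc (n + d)) * Q (n + d)"
      by (simp only: Q_def add_Suc_right qpoch_Suc) (simp add: algebra_simps)
    moreover have "n < k * Suc (n + d)"
      using assms by (cases k) auto
    ultimately show ?case
      using Suc by (simp add: fps_X_power_mult_nth del: mult_Suc_right)
  qed auto
  hence "fps_nth (Q N) n = fps_nth (euler_fps k) n" if "N \<ge> n" for N
    using le_Suc_ex[OF that] by (auto simp: euler_fps_def Q_def)
  thus "eventually (\<lambda>N. fps_nth (Q N) n = fps_nth (euler_fps k) n) sequentially"
    by (auto simp: eventually_sequentially)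
qed

lemma fps_nth_0_euler_fps [simp]: "fps_nth (euler_fps k) 0 = 1"
  by (simp add: euler_fps_def)

lemma qpoch_odd_even: "qpoch q (q ^ 2) n * qpoch (q ^ 2) (q ^ 2) n = qpoch q q (2 * n)"
  for q :: "'a::comm_ring_1"
proof (induction n)
  case (Suc n)
  have "qpoch q q (2 * Suc n) = qpoch q q (2 * n) * ((1 - q * q ^ (2 * n)) * (1 - q * q ^ (2 * n + 1)))"
    by (simp add: qpoch_Suc mult_ac)
  also have "q * q ^ (2 * n) = q * (q ^ 2) ^ n"
    by (simp add: power_mult)
  also have "q * q ^ (2 * n + 1) = q ^ 2 * (q ^ 2) ^ n"
    by (simp add: power_mult power2_eq_square mult.assoc)
  finally show ?case
    unfolding Suc.IH[symmetric] qpoch_Suc by (simp only: mult_ac)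
qed auto

section \<open>Two summation formulas\<close>

text \<open>Put V n = U n (1 - p^n)(1 - t p^n), so V 0 = 0. The summand on the right minus the one
  on the left is V (n+1) - V n. With x = p^n this is the identity (1 - a x^2)(1 - t x) + x^2 (1 - a
  x)(t - a p x) - (1 - x)(1 - t x) = x (1 - a x)(1 - a p x^2).\<close>

lemma telescoping_very_well_poised:
  fixes U :: "nat \<Rightarrow> 'a::comm_ring_1"
  assumes U: "\<And>n. U (Suc n) * ((1 - p ^ Suc n) * (1 - t * p ^ Suc n)) =
                    U n * (p ^ (2 * n) * (1 - a * p ^ n) * (t - a * p ^ Suc n))"
  shows "(\<Sum>n<M. U n * ((1 - a * p ^ (2 * n)) * (1 - t * p ^ n))) + U M * ((1 - p ^ M) * (1 - t * p ^ M)) =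
         (\<Sum>n<M. U n * ((1 - a * p ^ (2 * n + 1)) * p ^ n * (1 - a * p ^ n)))"
proof (induction M)
  case (Suc M)
  define x where "x = p ^ M"
  have [simp]: "p ^ (2 * M) = x * x" "p ^ (M * 2) = x * x" "p ^ M = x"
    by (simp_all add: x_def mult_2 mult_2_right power_add)
  show ?case
    unfolding sum.lessThan_Suc U Suc.IH[symmetric]
    by (simp add: algebra_simps)
qed auto

text \<open>The same scheme with V n = U n (1 - p^n)(1 - c p^n). With x = p^n the identity is (1 - c
  x) - x (z - c x) - (1 - x)(1 - c x) = x (1 - z).\<close>

lemma telescoping_q_gauss:
  fixes U :: "nat \<Rightarrow> 'a::comm_ring_1"
  assumes U: "\<And>n. U (Suc n) * ((1 - p ^ Suc n) * (1 - c * p ^ Suc n)) = - U n * (p ^ n * (z - c * p ^ n))"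
  shows "(\<Sum>n<M. U n * (1 - c * p ^ n)) + U M * ((1 - p ^ M) * (1 - c * p ^ M)) =
         (\<Sum>n<M. U n * (p ^ n * (1 - z)))"
proof (induction M)
  case (Suc M)
  define x where "x = p ^ M"
  have [simp]: "p ^ M = x"
    by (simp add: x_def)
  show ?case
    unfolding sum.lessThan_Suc U Suc.IH[symmetric]
    by (simp add: algebra_simps)
qed auto

text \<open>
  The very-well-poised \<open>\<^sub>6\<phi>\<^sub>5\<close> series in base \<open>p\<close> with parameters \<open>a\<close> and \<open>b = a p / t\<close>, the
  other two parameters sent to infinity; the product over \<open>k\<close> is \<open>(b; p)\<^sub>n t\<^sup>n\<close>, so that
  \<open>t\<close> may be any power series without constant term.
\<close>
definition vwp_term :: "'a::field fps \<Rightarrow> 'a fps \<Rightarrow> 'a fps \<Rightarrow> nat \<Rightarrow> 'a fps" where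
  "vwp_term p a t n = p ^ (n * (n - 1)) * (1 - a * p ^ (2 * n)) * qpoch a p n *
     (\<Prod>k<n. t - a * p ^ Suc k) * inverse (qpoch p p n * qpoch t p n)"

text \<open>
  The \<open>q\<close>-Gauss series \<open>\<^sub>2\<phi>\<^sub>1(a, b; c; p, c / (a b))\<close> with \<open>a = c / z\<close> and \<open>b\<close> sent to infinity.
\<close>
definition gauss_term :: "'a::field fps \<Rightarrow> 'a fps \<Rightarrow> 'a fps \<Rightarrow> nat \<Rightarrow> 'a fps" where
  "gauss_term p z c n = (-1) ^ n * p ^ (n * (n - 1) div 2) *
     (\<Prod>k<n. z - c * p ^ k) * inverse (qpoch p p n * qpoch c p n)"

lemma fps_X_power_dvd_prod:
  fixes f :: "nat \<Rightarrow> 'a::comm_ring_1 fps"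
  assumes "\<And>k. k < n \<Longrightarrow> fps_nth (f k) 0 = 0"
  shows   "fps_X ^ n dvd (\<Prod>k<n. f k)"
proof -
  have "fps_X dvd f k" if "k < n" for k
    using fps_X_power_dvd_iff[of 1 "f k"] assms[OF that] by simp
  hence "(\<Prod>k<n. fps_X) dvd (\<Prod>k<n. f k)"
    by (intro prod_dvd_prod) auto
  thus ?thesis by simp
qed

lemma fps_inverse_mult_self:
  fixes f :: "'a::field fps"
  assumes "fps_nth f 0 = 1"
  shows   "inverse f * f = 1" "inverse f * (f * g) = g" "f * inverse f = 1" "f * (inverse f * g) = g"
proof -
  show 1: "inverse f * f = 1" by (rule inverse_mult_eq_1) (use assms in auto)
  thus "inverse f * (f * g) = g" "f * inverse f = 1" "f * (inverse f * g) = g"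
    by (simp_all add: mult.assoc[symmetric] mult.commute)
qed

section \<open>Shifting both parameters by the base\<close>

context
  fixes p :: "'a::field fps"
  assumes p0 [simp]: "fps_nth p 0 = 0"
begin

lemma vwp_term_dvd:
  assumes "fps_nth a 0 = 0" "fps_nth t 0 = 0"
  shows   "fps_X ^ n dvd vwp_term p a t n"
  unfolding vwp_term_def using assms
  by (intro dvd_mult dvd_mult2 fps_X_power_dvd_prod) (auto simp: fps_mult_nth_0)

lemma gauss_term_dvd:
  assumes "fps_nth z 0 = 0" "fps_nth c 0 = 0"
  shows   "fps_X ^ n dvd gauss_term p z c n"
  unfolding gauss_term_def using assms
  by (intro dvd_mult dvd_mult2 fps_X_power_dvd_prod) (auto simp: fps_mult_nth_0)

lemma suminf_vwp_term_shift:
  assumes a [simp]: "fps_nth a 0 = 0" and t [simp]: "fps_nth t 0 = 0"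
  shows "(1 - t) * suminf (vwp_term p a t) = (1 - a) * suminf (vwp_term p (a * p) (t * p))"
proof -
  \<comment> \<open>\<open>U\<close> is the common part of the summands for (a, t) and (a p, t p):
    the factor \<open>1 - a * p ^ (2 * n)\<close> is dropped and the product in t is one factor
    longer. \<open>term1\<close> and \<open>term2\<close> recover the two summands from it.\<close>
  define U where "U n = p ^ (n * (n - 1)) * qpoch a p n *
     (\<Prod>k<n. t - a * p ^ Suc k) * inverse (qpoch p p n * qpoch t p (Suc n))" for n
  have one [simp]: "fps_nth (1 - t * p ^ n) 0 = 1" "fps_nth (1 - p ^ Suc n) 0 = 1" "fps_nth (1 - t) 0 = 1" for n
    by (simp_all add: fps_mult_nth_0)
  have U_Suc: "U (Suc n) * ((1 - p ^ Suc n) * (1 - t * p ^ Suc n)) =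
                 U n * (p ^ (2 * n) * (1 - a * p ^ n) * (t - a * p ^ Suc n))" for n
  proof -
    have e: "Suc n * (Suc n - 1) = 2 * n + n * (n - 1)"
      by (cases n) auto
    have q: "qpoch p p (Suc n) = qpoch p p n * (1 - p ^ Suc n)"
      by (simp add: qpoch_Suc)
    have q': "qpoch t p (Suc (Suc n)) = qpoch t p (Suc n) * (1 - t * p ^ Suc n)"
      by (rule qpoch_Suc)
    have "U (Suc n) * ((1 - p ^ Suc n) * (1 - t * p ^ Suc n)) =
            U n * (p ^ (2 * n) * (1 - a * p ^ n) * (t - a * p ^ Suc n)) *
            (inverse (1 - p ^ Suc n) * (1 - p ^ Suc n)) *
            (inverse (1 - t * p ^ Suc n) * (1 - t * p ^ Suc n))"
      unfolding U_def e q q' qpoch_Suc[of a] prod.lessThan_Suc fps_inverse_mult power_add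
      by (simp only: mult_ac)
    thus ?thesis
      by (simp only: fps_inverse_mult_self one mult_1_right)
  qed
  have term1: "U n * ((1 - a * p ^ (2 * n)) * (1 - t * p ^ n)) = vwp_term p a t n" for n
  proof -
    have "U n * ((1 - a * p ^ (2 * n)) * (1 - t * p ^ n)) =
            vwp_term p a t n * (inverse (1 - t * p ^ n) * (1 - t * p ^ n))"
      unfolding U_def vwp_term_def qpoch_Suc fps_inverse_mult by (simp only: mult_ac)
    thus ?thesis
      by (simp only: fps_inverse_mult_self one mult_1_right)
  qed
  have term2: "(1 - t) * (U n * ((1 - a * p ^ (2 * n + 1)) * p ^ n * (1 - a * p ^ n))) =
                 (1 - a) * vwp_term p (a * p) (t * p) n" for n
  proof -
    have "(\<Prod>k<n. t * p - a * p * p ^ Suc k) = (\<Prod>k<n. p * (t - a * p ^ Suc k))"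
      by (intro prod.cong) (auto simp: algebra_simps)
    hence pr: "(\<Prod>k<n. t * p - a * p * p ^ Suc k) = p ^ n * (\<Prod>k<n. t - a * p ^ Suc k)"
      by (simp add: prod.distrib)
    have qa: "(1 - a) * qpoch (a * p) p n = qpoch a p n * (1 - a * p ^ n)"
      by (simp only: qpoch_Suc_shift[symmetric] qpoch_Suc)
    have "(1 - t) * (U n * ((1 - a * p ^ (2 * n + 1)) * p ^ n * (1 - a * p ^ n))) =
            p ^ (n * (n - 1)) * (qpoch a p n * (1 - a * p ^ n)) * (p ^ n * (\<Prod>k<n. t - a * p ^ Suc k)) *
            (1 - a * p ^ (2 * n + 1)) * inverse (qpoch p p n) * inverse (qpoch (t * p) p n) *
            (inverse (1 - t) * (1 - t))"
      unfolding U_def qpoch_Suc_shift[of t] fps_inverse_mult by (simp only: mult_ac)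
    also have "\<dots> = (1 - a) * vwp_term p (a * p) (t * p) n"
      unfolding fps_inverse_mult_self[OF one(3)] vwp_term_def pr qa[symmetric] fps_inverse_mult
      by (simp add: mult_ac)
    finally show ?thesis .
  qed
  \<comment> \<open>The boundary term contains n factors without constant term, so it vanishes
    q-adically.\<close>
  have U_lim: "(\<lambda>n. U n * ((1 - p ^ n) * (1 - t * p ^ n))) \<longlonglongrightarrow> 0"
    unfolding U_def
    by (intro tendsto_0_fpsI dvd_mult2 dvd_mult fps_X_power_dvd_prod) (auto simp: fps_mult_nth_0)
  have "(\<lambda>M. (1 - t) * ((\<Sum>n<M. vwp_term p a t n) + U M * ((1 - p ^ M) * (1 - t * p ^ M))))
          \<longlonglongrightarrow> (1 - t) * (suminf (vwp_term p a t) + 0)"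
    using suminf_fps_sums[OF vwp_term_dvd[of a t]] unfolding sums_def
    by (intro tendsto_mult_fps tendsto_add_fps U_lim tendsto_const) auto
  also have "(\<lambda>M. (1 - t) * ((\<Sum>n<M. vwp_term p a t n) + U M * ((1 - p ^ M) * (1 - t * p ^ M)))) =
             (\<lambda>M. (1 - a) * (\<Sum>n<M. vwp_term p (a * p) (t * p) n))"
    using telescoping_very_well_poised[of U p t a, OF U_Suc]
    by (simp only: term1 term2 sum_distrib_left)
  finally have "(\<lambda>M. (1 - a) * (\<Sum>n<M. vwp_term p (a * p) (t * p) n)) \<longlonglongrightarrow> (1 - t) * suminf (vwp_term p a t)"
    by simp
  moreover have "(\<lambda>M. (1 - a) * (\<Sum>n<M. vwp_term p (a * p) (t * p) n)) \<longlonglongrightarrow>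
                   (1 - a) * suminf (vwp_term p (a * p) (t * p))"
    using suminf_fps_sums[OF vwp_term_dvd[of "a * p" "t * p"]] unfolding sums_def
    by (intro tendsto_mult_fps tendsto_const) (auto simp: fps_mult_nth_0)
  ultimately show ?thesis
    by (rule LIMSEQ_unique)
qed

lemma suminf_gauss_term_shift:
  assumes z [simp]: "fps_nth z 0 = 0" and c [simp]: "fps_nth c 0 = 0"
  shows "(1 - c) * suminf (gauss_term p z c) = (1 - z) * suminf (gauss_term p (z * p) (c * p))"
proof -
  \<comment> \<open>Again the summand with the product in c made one factor longer, from which the
    summands for (z, c) and (z p, c p) both arise.\<close>
  define U where "U n = (-1) ^ n * p ^ (n * (n - 1) div 2) *
     (\<Prod>k<n. z - c * p ^ k) * inverse (qpoch p p n * qpoch c p (Suc n))" for n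
  have one [simp]: "fps_nth (1 - c * p ^ n) 0 = 1" "fps_nth (1 - p ^ Suc n) 0 = 1" "fps_nth (1 - c) 0 = 1" for n
    by (simp_all add: fps_mult_nth_0)
  have U_Suc: "U (Suc n) * ((1 - p ^ Suc n) * (1 - c * p ^ Suc n)) = - U n * (p ^ n * (z - c * p ^ n))" for n
  proof -
    have "Suc n * (Suc n - 1) = n * (n - 1) + n * 2"
      by (cases n) auto
    hence e: "Suc n * (Suc n - 1) div 2 = n + n * (n - 1) div 2"
      by simp
    have q: "qpoch p p (Suc n) = qpoch p p n * (1 - p ^ Suc n)"
      by (simp add: qpoch_Suc)
    have q': "qpoch c p (Suc (Suc n)) = qpoch c p (Suc n) * (1 - c * p ^ Suc n)"
      by (rule qpoch_Suc)
    have "U (Suc n) * ((1 - p ^ Suc n) * (1 - c * p ^ Suc n)) =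
            (- 1) * (U n * (p ^ n * (z - c * p ^ n)) *
            (inverse (1 - p ^ Suc n) * (1 - p ^ Suc n)) *
            (inverse (1 - c * p ^ Suc n) * (1 - c * p ^ Suc n)))"
      unfolding U_def e q q' prod.lessThan_Suc fps_inverse_mult power_add power_Suc[of "-1"]
      by (simp only: mult_ac)
    thus ?thesis
      by (simp only: fps_inverse_mult_self one mult_1_right) simp
  qed
  have term1: "U n * (1 - c * p ^ n) = gauss_term p z c n" for n
  proof -
    have "U n * (1 - c * p ^ n) = gauss_term p z c n * (inverse (1 - c * p ^ n) * (1 - c * p ^ n))"
      unfolding U_def gauss_term_def qpoch_Suc fps_inverse_mult by (simp only: mult_ac)
    thus ?thesis
      by (simp only: fps_inverse_mult_self one mult_1_right)
  qed
  have term2: "(1 - c) * (U n * (p ^ n * (1 - z))) = (1 - z) * gauss_term p (z * p) (c * p) n" for n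
  proof -
    have "(\<Prod>k<n. z * p - c * p * p ^ k) = (\<Prod>k<n. p * (z - c * p ^ k))"
      by (intro prod.cong) (auto simp: algebra_simps)
    hence pr: "(\<Prod>k<n. z * p - c * p * p ^ k) = p ^ n * (\<Prod>k<n. z - c * p ^ k)"
      by (simp add: prod.distrib)
    have "(1 - c) * (U n * (p ^ n * (1 - z))) =
            (1 - z) * gauss_term p (z * p) (c * p) n * (inverse (1 - c) * (1 - c))"
      unfolding U_def gauss_term_def pr qpoch_Suc_shift[of c] fps_inverse_mult by (simp only: mult_ac)
    thus ?thesis
      by (simp only: fps_inverse_mult_self one mult_1_right)
  qed
  have U_lim: "(\<lambda>n. U n * ((1 - p ^ n) * (1 - c * p ^ n))) \<longlonglongrightarrow> 0"
    unfolding U_def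
    by (intro tendsto_0_fpsI dvd_mult2 dvd_mult fps_X_power_dvd_prod) (auto simp: fps_mult_nth_0)
  have "(\<lambda>M. (1 - c) * ((\<Sum>n<M. gauss_term p z c n) + U M * ((1 - p ^ M) * (1 - c * p ^ M))))
          \<longlonglongrightarrow> (1 - c) * (suminf (gauss_term p z c) + 0)"
    using suminf_fps_sums[OF gauss_term_dvd[of z c]] unfolding sums_def
    by (intro tendsto_mult_fps tendsto_add_fps U_lim tendsto_const) auto
  also have "(\<lambda>M. (1 - c) * ((\<Sum>n<M. gauss_term p z c n) + U M * ((1 - p ^ M) * (1 - c * p ^ M)))) =
             (\<lambda>M. (1 - z) * (\<Sum>n<M. gauss_term p (z * p) (c * p) n))"
    using telescoping_q_gauss[of U p c z, OF U_Suc]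
    by (simp only: term1 term2 sum_distrib_left)
  finally have "(\<lambda>M. (1 - z) * (\<Sum>n<M. gauss_term p (z * p) (c * p) n)) \<longlonglongrightarrow> (1 - c) * suminf (gauss_term p z c)"
    by simp
  moreover have "(\<lambda>M. (1 - z) * (\<Sum>n<M. gauss_term p (z * p) (c * p) n)) \<longlonglongrightarrow>
                   (1 - z) * suminf (gauss_term p (z * p) (c * p))"
    using suminf_fps_sums[OF gauss_term_dvd[of "z * p" "c * p"]] unfolding sums_def
    by (intro tendsto_mult_fps tendsto_const) (auto simp: fps_mult_nth_0)
  ultimately show ?thesis
    by (rule LIMSEQ_unique)
qed

section \<open>Iterating the shift to the limit\<close>

lemma suminf_vwp_term_iterate:
  assumes a [simp]: "fps_nth a 0 = 0" and t [simp]: "fps_nth t 0 = 0"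
  shows "qpoch t p N * suminf (vwp_term p a t) = qpoch a p N * suminf (vwp_term p (a * p ^ N) (t * p ^ N))"
proof (induction N)
  case (Suc N)
  have "qpoch t p (Suc N) * suminf (vwp_term p a t) =
          (1 - t * p ^ N) * (qpoch t p N * suminf (vwp_term p a t))"
    by (simp add: qpoch_Suc mult_ac)
  also have "\<dots> = qpoch a p N * ((1 - t * p ^ N) * suminf (vwp_term p (a * p ^ N) (t * p ^ N)))"
    by (simp add: Suc.IH mult_ac)
  also have "\<dots> = qpoch a p (Suc N) * suminf (vwp_term p (a * p ^ N * p) (t * p ^ N * p))"
    by (subst suminf_vwp_term_shift) (auto simp: qpoch_Suc mult_ac fps_mult_nth_0)
  finally show ?case
    by (simp add: mult_ac)
qed auto

lemma suminf_gauss_term_iterate: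
  assumes z [simp]: "fps_nth z 0 = 0" and c [simp]: "fps_nth c 0 = 0"
  shows "qpoch c p N * suminf (gauss_term p z c) =
           qpoch z p N * suminf (gauss_term p (z * p ^ N) (c * p ^ N))"
proof (induction N)
  case (Suc N)
  have "qpoch c p (Suc N) * suminf (gauss_term p z c) =
          (1 - c * p ^ N) * (qpoch c p N * suminf (gauss_term p z c))"
    by (simp add: qpoch_Suc mult_ac)
  also have "\<dots> = qpoch z p N * ((1 - c * p ^ N) * suminf (gauss_term p (z * p ^ N) (c * p ^ N)))"
    by (simp add: Suc.IH mult_ac)
  also have "\<dots> = qpoch z p (Suc N) * suminf (gauss_term p (z * p ^ N * p) (c * p ^ N * p))"
    by (subst suminf_gauss_term_shift) (auto simp: qpoch_Suc mult_ac fps_mult_nth_0)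
  finally show ?case
    by (simp add: mult_ac)
qed auto

lemma fps_X_power_dvd_power: "fps_X ^ n dvd p ^ n"
  using fps_X_power_dvd_prod[of n "\<lambda>_. p"] by simp

text \<open>Below degree N only the term with index 0 survives, and there it agrees with 1.\<close>

lemma tendsto_suminf_fps_1:
  fixes T :: "nat \<Rightarrow> nat \<Rightarrow> 'a fps"
  assumes "\<And>N n. fps_X ^ n dvd T N n" "\<And>N. fps_X ^ N dvd T N 0 - 1"
  assumes "\<And>N n. n > 0 \<Longrightarrow> fps_X ^ N dvd T N n"
  shows   "(\<lambda>N. suminf (T N)) \<longlonglongrightarrow> 1"
proof (rule tendsto_fpsI)
  fix k
  have "fps_nth (suminf (T N)) k = fps_nth 1 k" if "k < N" for N
  proof -
    have "fps_nth (suminf (T N)) k = (\<Sum>n\<le>k. fps_nth (T N n) k)"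
      using assms(1) by (rule fps_nth_suminf)
    also have "\<dots> = (\<Sum>n\<in>{0}. fps_nth (T N n) k)"
      using assms(3)[of _ N] that by (intro sum.mono_neutral_right) (auto simp: fps_X_power_dvd_iff)
    also have "\<dots> = fps_nth 1 k"
      using assms(2)[of N] that by (auto simp: fps_X_power_dvd_iff)
    finally show ?thesis .
  qed
  thus "eventually (\<lambda>N. fps_nth (suminf (T N)) k = fps_nth 1 k) sequentially"
    by (rule eventually_mono[OF eventually_gt_at_top])
qed

lemma tendsto_suminf_vwp_term:
  assumes [simp]: "fps_nth a 0 = 0" "fps_nth t 0 = 0"
  shows "(\<lambda>N. suminf (vwp_term p (a * p ^ N) (t * p ^ N))) \<longlonglongrightarrow> 1"
proof (rule tendsto_suminf_fps_1)
  fix N n :: nat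
  show "fps_X ^ n dvd vwp_term p (a * p ^ N) (t * p ^ N) n"
    by (rule vwp_term_dvd) (auto simp: fps_mult_nth_0)
  have "fps_X ^ N dvd p ^ N * a"
    by (intro dvd_mult2 fps_X_power_dvd_power)
  thus "fps_X ^ N dvd vwp_term p (a * p ^ N) (t * p ^ N) 0 - 1"
    by (simp add: vwp_term_def mult_ac)
  assume "n > 0"
  \<comment> \<open>The factor k = 0, present because n > 0, already supplies
    \<open>p ^ N\<close>.\<close>
  hence "p ^ N dvd (\<Prod>k<n. t * p ^ N - a * p ^ N * p ^ Suc k)"
    by (intro dvd_prodI[of _ 0, THEN dvd_trans[rotated]] dvd_diff) auto
  hence "p ^ N dvd vwp_term p (a * p ^ N) (t * p ^ N) n"
    unfolding vwp_term_def by (intro dvd_mult dvd_mult2)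
  thus "fps_X ^ N dvd vwp_term p (a * p ^ N) (t * p ^ N) n"
    by (rule dvd_trans[OF fps_X_power_dvd_power])
qed

lemma tendsto_suminf_gauss_term:
  assumes [simp]: "fps_nth z 0 = 0" "fps_nth c 0 = 0"
  shows "(\<lambda>N. suminf (gauss_term p (z * p ^ N) (c * p ^ N))) \<longlonglongrightarrow> 1"
proof (rule tendsto_suminf_fps_1)
  fix N n :: nat
  show "fps_X ^ n dvd gauss_term p (z * p ^ N) (c * p ^ N) n"
    by (rule gauss_term_dvd) (auto simp: fps_mult_nth_0)
  show "fps_X ^ N dvd gauss_term p (z * p ^ N) (c * p ^ N) 0 - 1"
    by (simp add: gauss_term_def)
  assume "n > 0"
  hence "p ^ N dvd (\<Prod>k<n. z * p ^ N - c * p ^ N * p ^ k)"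
    by (intro dvd_prodI[of _ 0, THEN dvd_trans[rotated]] dvd_diff) auto
  hence "p ^ N dvd gauss_term p (z * p ^ N) (c * p ^ N) n"
    unfolding gauss_term_def by (intro dvd_mult dvd_mult2)
  thus "fps_X ^ N dvd gauss_term p (z * p ^ N) (c * p ^ N) n"
    by (rule dvd_trans[OF fps_X_power_dvd_power])
qed

end

section \<open>The two series for f_1 / f_2^2\<close>

lemma euler_fps_quotient_eqI:
  fixes S :: "'a::field fps"
  assumes "\<And>N. qpoch (fps_X ^ 2) (fps_X ^ 2) N * S = qpoch fps_X (fps_X ^ 2) N * R N"
  assumes "R \<longlonglongrightarrow> 1"
  shows   "euler_fps 2 ^ 2 * S = euler_fps 1"
proof -
  define Q :: "nat \<Rightarrow> 'a fps" where "Q = qpoch (fps_X ^ 2) (fps_X ^ 2)"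
  have lim: "Q \<longlonglongrightarrow> euler_fps 2"
    unfolding Q_def by (rule qpoch_tendsto_euler_fps) auto
  have "(\<lambda>N. Q N ^ 2 * S) \<longlonglongrightarrow> euler_fps 2 ^ 2 * S"
    by (intro tendsto_mult_fps tendsto_power_fps lim tendsto_const)
  \<comment> \<open>The second copy of (q^2; q^2)_N joins (q; q^2)_N to give (q; q)_2N, which tends
    to f_1. This is why f_2 enters squared.\<close>
  moreover have "Q N ^ 2 * S = qpoch fps_X fps_X (2 * N) * R N" for N
  proof -
    have "Q N ^ 2 * S = Q N * (Q N * S)"
      by (simp add: power2_eq_square mult_ac)
    also have "\<dots> = (qpoch fps_X (fps_X ^ 2) N * Q N) * R N"
      using assms(1)[of N] by (simp add: Q_def mult_ac)
    finally show ?thesis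
      by (simp only: Q_def qpoch_odd_even)
  qed
  moreover have "(\<lambda>N. qpoch fps_X fps_X (2 * N) * R N) \<longlonglongrightarrow> euler_fps 1 * 1"
  proof (intro tendsto_mult_fps assms(2))
    have "qpoch fps_X fps_X \<longlonglongrightarrow> (euler_fps 1 :: 'a fps)"
      using qpoch_tendsto_euler_fps[of 1, where 'a = 'a] by simp
    thus "(\<lambda>N. qpoch fps_X fps_X (2 * N)) \<longlonglongrightarrow> (euler_fps 1 :: 'a fps)"
      by (rule filterlim_compose) (rule mult_nat_left_at_top, simp)
  qed
  ultimately show ?thesis
    using LIMSEQ_unique by auto
qed

lemma suminf_vwp_term_eq: "euler_fps 2 ^ 2 * suminf (vwp_term (fps_X ^ 2) fps_X (fps_X ^ 2)) = (euler_fps 1 :: 'a::field fps)"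
  by (rule euler_fps_quotient_eqI[OF suminf_vwp_term_iterate tendsto_suminf_vwp_term]) auto

lemma suminf_gauss_term_eq: "euler_fps 2 ^ 2 * suminf (gauss_term (fps_X ^ 2) fps_X (fps_X ^ 2)) = (euler_fps 1 :: 'a::field fps)"
  by (rule euler_fps_quotient_eqI[OF suminf_gauss_term_iterate tendsto_suminf_gauss_term]) auto

lemma prod_fps_X_odd:
  "(\<Prod>k<n. fps_X - fps_X ^ 2 * (fps_X ^ 2) ^ k) = fps_X ^ n * (qpoch fps_X (fps_X ^ 2) n :: 'a::field fps)"
proof -
  have "(\<Prod>k<n. fps_X - fps_X ^ 2 * (fps_X ^ 2) ^ k) = (\<Prod>k<n. fps_X * (1 - fps_X * (fps_X ^ 2 :: 'a fps) ^ k))"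
    by (intro prod.cong) (auto simp: algebra_simps power2_eq_square)
  thus ?thesis
    by (simp add: prod.distrib qpoch_def)
qed

text \<open>This is the summand of \<open>mock_mu2\<close> except that the denominator has (q^2;
  q^2)_n instead of (-q^2; q^2)_n, a difference that disappears modulo 2.\<close>

lemma gauss_term_specialise:
  "gauss_term (fps_X ^ 2) fps_X (fps_X ^ 2) n =
     ((-1) ^ n * fps_X ^ (n ^ 2) * qpoch fps_X (fps_X ^ 2) n / qpoch (fps_X ^ 2) (fps_X ^ 2) n ^ 2 :: 'a::field fps)"
proof -
  have "even (n * (n - 1))"
    by (cases n) auto
  hence "2 * (n * (n - 1) div 2) + n = n ^ 2"
    by (cases n) (auto simp: power2_eq_square)
  hence "(fps_X ^ 2) ^ (n * (n - 1) div 2) * fps_X ^ n = (fps_X ^ (n ^ 2) :: 'a fps)"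
    by (simp only: power_mult[symmetric] power_add[symmetric])
  moreover have "fps_nth (qpoch (fps_X ^ 2) (fps_X ^ 2) n ^ 2 :: 'a fps) 0 \<noteq> 0"
    by (simp add: fps_power_zeroth)
  moreover have "gauss_term (fps_X ^ 2) fps_X (fps_X ^ 2) n =
      (-1) ^ n * ((fps_X ^ 2) ^ (n * (n - 1) div 2) * fps_X ^ n) * qpoch fps_X (fps_X ^ 2) n *
      inverse (qpoch (fps_X ^ 2) (fps_X ^ 2) n ^ 2 :: 'a fps)"
    unfolding gauss_term_def prod_fps_X_odd power2_eq_square[of "qpoch _ _ _"] by (simp only: mult_ac)
  ultimately show ?thesis
    by (simp only: fps_divide_unit not_False_eq_True)
qed

text \<open>With a = q and p = t = q^2 the other parameter b = a p / t is also q. Numerator and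
  denominator therefore contain squared products, ready for the Frobenius map.\<close>

lemma vwp_term_specialise:
  "vwp_term (fps_X ^ 2) fps_X (fps_X ^ 2) n =
     (fps_X ^ (2 * n ^ 2) * (1 - fps_X ^ (4 * n + 1)) * qpoch fps_X (fps_X ^ 2) n ^ 2 /
        qpoch (fps_X ^ 2) (fps_X ^ 2) n ^ 2 :: 'a::field fps)"
proof -
  have pr: "(\<Prod>k<n. fps_X ^ 2 - fps_X * (fps_X ^ 2) ^ Suc k) = fps_X ^ n * (\<Prod>k<n. fps_X - fps_X ^ 2 * (fps_X ^ 2 :: 'a fps) ^ k)"
  proof -
    have "(\<Prod>k<n. fps_X ^ 2 - fps_X * (fps_X ^ 2) ^ Suc k) = (\<Prod>k<n. fps_X * (fps_X - fps_X ^ 2 * (fps_X ^ 2 :: 'a fps) ^ k))"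
      by (intro prod.cong) (auto simp: algebra_simps power2_eq_square)
    thus ?thesis
      by (simp add: prod.distrib)
  qed
  have "2 * (n * (n - 1)) + n + n = 2 * n ^ 2"
    by (cases n) (auto simp: power2_eq_square)
  hence "(fps_X ^ 2) ^ (n * (n - 1)) * fps_X ^ n * fps_X ^ n = (fps_X ^ (2 * n ^ 2) :: 'a fps)"
    by (simp only: power_mult[symmetric] power_add[symmetric])
  moreover have "fps_X * (fps_X ^ 2) ^ (2 * n) = (fps_X ^ (4 * n + 1) :: 'a fps)"
    by (simp add: power_mult[symmetric])
  moreover have "fps_nth (qpoch (fps_X ^ 2) (fps_X ^ 2) n ^ 2 :: 'a fps) 0 \<noteq> 0"
    by (simp add: fps_power_zeroth)
  moreover have "vwp_term (fps_X ^ 2) fps_X (fps_X ^ 2) n =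
      ((fps_X ^ 2) ^ (n * (n - 1)) * fps_X ^ n * fps_X ^ n) * (1 - fps_X * (fps_X ^ 2) ^ (2 * n)) *
      qpoch fps_X (fps_X ^ 2) n ^ 2 * inverse (qpoch (fps_X ^ 2) (fps_X ^ 2) n ^ 2 :: 'a fps)"
    unfolding vwp_term_def pr prod_fps_X_odd power2_eq_square[of "qpoch _ _ _"] by (simp only: mult_ac)
  ultimately show ?thesis
    by (simp only: fps_divide_unit not_False_eq_True)
qed

section \<open>Power series modulo 2\<close>

lemma bit_fps_add_self: "f + f = (0 :: bit fps)"
proof (rule fps_ext)
  fix n show "fps_nth (f + f) n = fps_nth 0 n"
    by (cases "fps_nth f n") auto
qed

lemma bit_fps_uminus: "- f = (f :: bit fps)"
  using bit_fps_add_self[of f] by (rule minus_unique)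

lemma bit_fps_diff: "f - g = f + (g :: bit fps)"
  using bit_fps_uminus[of g] by (simp only: diff_conv_add_uminus)

lemma bit_fps_add_square: "(f + g) ^ 2 = f ^ 2 + (g :: bit fps) ^ 2"
proof -
  have "(f + g) ^ 2 = f ^ 2 + g ^ 2 + (f * g + f * g)"
    by (simp only: power2_eq_square distrib_left distrib_right ac_simps)
  thus ?thesis
    by (simp only: bit_fps_add_self add_0_right)
qed

lemma bit_fps_sum_square: "(\<Sum>n\<in>A. f n) ^ 2 = (\<Sum>n\<in>A. (f n :: bit fps) ^ 2)"
  by (induction A rule: infinite_finite_induct) (auto simp: bit_fps_add_square)

lemma bit_qpoch_square: "qpoch a q n ^ 2 = qpoch (a ^ 2 :: bit fps) (q ^ 2) n"
proof (induction n)
  case (Suc n)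
  have "(1 - a * q ^ n) ^ 2 = 1 - a ^ 2 * (q ^ 2) ^ n"
    unfolding bit_fps_diff bit_fps_add_square by (simp add: power_mult_distrib power_mult[symmetric] mult_ac)
  with Suc show ?case
    by (simp add: qpoch_Suc power_mult_distrib)
qed auto

lemma bit_euler_fps_square:
  assumes "k > 0"
  shows   "euler_fps k ^ 2 = (euler_fps (2 * k) :: bit fps)"
proof -
  have "(\<lambda>N. qpoch (fps_X ^ k) (fps_X ^ k) N ^ 2) \<longlonglongrightarrow> (euler_fps k :: bit fps) ^ 2"
    using assms by (intro tendsto_power_fps qpoch_tendsto_euler_fps)
  also have "(\<lambda>N. qpoch (fps_X ^ k) (fps_X ^ k) N ^ 2) = qpoch (fps_X ^ (2 * k)) (fps_X ^ (2 * k) :: bit fps)"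
    by (simp add: bit_qpoch_square fun_eq_iff power_mult[symmetric] mult.commute)
  finally show ?thesis
    using qpoch_tendsto_euler_fps[of "2 * k", where 'a = bit] assms by (intro LIMSEQ_unique) auto
qed

text \<open>Turns every eta quotient whose levels are powers of 2 into a single power of f_1 modulo
  2.\<close>

lemma bit_euler_fps_power_of_2: "euler_fps (2 ^ i) = (euler_fps 1 :: bit fps) ^ (2 ^ i)"
proof (induction i)
  case (Suc i)
  have "euler_fps (2 ^ Suc i) = (euler_fps (2 ^ i) :: bit fps) ^ 2"
    by (simp add: bit_euler_fps_square)
  thus ?case
    by (simp add: Suc.IH power_mult[symmetric] mult.commute)
qed auto

text \<open>This is f(q)^2 = f(q^2) over \<open>bit\<close>. Writing f = c + q g with c a constant
  gives f^2 = c + q^2 g^2, since c^2 = c, and the induction continues with g.\<close>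

lemma bit_fps_square_nth:
  "fps_nth (f ^ 2) n = (if even n then fps_nth f (n div 2) else (0 :: bit))"
proof (induction n arbitrary: f rule: less_induct)
  case (less n f)
  define g where "g = fps_shift 1 f"
  have f: "f = fps_const (fps_nth f 0) + fps_X * g"
    by (rule fps_ext) (auto simp: g_def)
  have "f ^ 2 = fps_const (fps_nth f 0) + fps_X ^ 2 * g ^ 2"
    by (subst f, subst bit_fps_add_square)
       (auto simp: power_mult_distrib fps_const_power)
  hence *: "fps_nth (f ^ 2) n = (if n = 0 then fps_nth f 0 else if n < 2 then 0 else fps_nth (g ^ 2) (n - 2))"
    by (simp add: fps_X_power_mult_nth)
  show ?case
  proof (cases "n < 2")
    case True
    thus ?thesis unfolding * by (auto simp: less_2_cases_iff)
  next
    case False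
    hence "fps_nth (f ^ 2) n = fps_nth (g ^ 2) (n - 2)"
      unfolding * by simp
    also have "\<dots> = (if even (n - 2) then fps_nth g ((n - 2) div 2) else 0)"
      using False by (intro less) auto
    also have "(n - 2) div 2 = n div 2 - 1" "even (n - 2) \<longleftrightarrow> even n" "n div 2 \<ge> 1"
      using False by auto
    thus ?thesis
      using calculation by (simp add: g_def)
  qed
qed

lemma bit_fps_power8_nth: "fps_nth (f ^ 8) n = (if 8 dvd n then fps_nth f (n div 8) else (0 :: bit))"
proof -
  have "f ^ 8 = ((f ^ 2) ^ 2) ^ 2"
    by (simp flip: power_mult)
  moreover have "8 dvd n \<longleftrightarrow> even n \<and> even (n div 2) \<and> even (n div 2 div 2)"
    by presburger
  ultimately show ?thesis
    by (simp only: bit_fps_square_nth) (auto simp: div_mult2_eq[symmetric])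
qed

section \<open>Mock theta functions modulo 2\<close>

text \<open>The summands are stated over any field, so that one expression can be read both over
  \<open>complex\<close> and over \<open>bit\<close>.\<close>

definition mu2_term :: "nat \<Rightarrow> 'a::field fps" where
  "mu2_term n = (-1) ^ n * fps_X ^ (n ^ 2) * qpoch fps_X (fps_X ^ 2) n / qpoch (- (fps_X ^ 2)) (fps_X ^ 2) n ^ 2"

definition U0_term :: "nat \<Rightarrow> 'a::field fps" where
  "U0_term n = fps_X ^ (n ^ 2) * qpoch (- fps_X) (fps_X ^ 2) n / qpoch (- (fps_X ^ 4)) (fps_X ^ 4) n"

definition S0_term :: "nat \<Rightarrow> 'a::field fps" where
  "S0_term n = fps_X ^ (n ^ 2) * qpoch (- fps_X) (fps_X ^ 2) n / qpoch (- (fps_X ^ 2)) (fps_X ^ 2) n"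

definition S1_term :: "nat \<Rightarrow> 'a::field fps" where
  "S1_term n = fps_X ^ (n * (n + 2)) * qpoch (- fps_X) (fps_X ^ 2) n / qpoch (- (fps_X ^ 2)) (fps_X ^ 2) n"

lemma mock_eq_suminf:
  "mock_mu2 = suminf mu2_term" "mock_U0 = suminf U0_term"
  "mock_S0 = suminf S0_term" "mock_S1 = suminf S1_term"
  by (simp_all add: mock_mu2_def mock_U0_def mock_S0_def mock_S1_def
        mu2_term_def[abs_def] U0_term_def[abs_def] S0_term_def[abs_def] S1_term_def[abs_def] Let_def)

lemma mock_term_dvd:
  "fps_X ^ n dvd (mu2_term n :: 'a::field fps)" "fps_X ^ n dvd (U0_term n :: 'a fps)"
  "fps_X ^ n dvd (S0_term n :: 'a fps)" "fps_X ^ n dvd (S1_term n :: 'a fps)"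
proof -
  have le: "n \<le> n ^ 2" "n \<le> n * (n + 2)"
    by (auto simp: power2_eq_square)
  have div: "fps_X ^ n dvd A / B" if "fps_X ^ n dvd A" "fps_nth B 0 = 1" for A B :: "'a fps"
    using that by (auto simp: fps_divide_unit)
  show "fps_X ^ n dvd (mu2_term n :: 'a fps)"
    unfolding mu2_term_def
    by (rule div, rule dvd_mult2, rule dvd_mult, rule le_imp_power_dvd[OF le(1)])
       (simp add: fps_power_zeroth)
  show "fps_X ^ n dvd (U0_term n :: 'a fps)" "fps_X ^ n dvd (S0_term n :: 'a fps)"
    unfolding U0_term_def S0_term_def
    by (rule div, rule dvd_mult2, rule le_imp_power_dvd[OF le(1)], simp)+
  show "fps_X ^ n dvd (S1_term n :: 'a fps)"
    unfolding S1_term_def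
    by (rule div, rule dvd_mult2, rule le_imp_power_dvd[OF le(2)]) simp
qed

lemma bit_mu2_term: "mu2_term = gauss_term (fps_X ^ 2) fps_X (fps_X ^ 2 :: bit fps)"
  by (rule ext) (simp only: mu2_term_def gauss_term_specialise bit_fps_uminus)

text \<open>The Frobenius map turns the squared denominator (q^2; q^2)_n^2 into (q^4; q^4)_n, and
  signs are irrelevant, so the summands agree one by one.\<close>

lemma bit_U0_term: "U0_term = (mu2_term :: nat \<Rightarrow> bit fps)"
proof -
  have "(- 1) ^ n = (1 :: bit fps)" for n
    by (simp only: bit_fps_uminus power_one)
  moreover have "(fps_X ^ 2) ^ 2 = (fps_X ^ 4 :: bit fps)"
    by (simp flip: power_mult)
  ultimately show ?thesis
    by (intro ext) (simp only: mu2_term_def U0_term_def bit_fps_uminus bit_qpoch_square mult_1_left)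
qed

text \<open>The factor 1 + q^(4n+1) splits the summand in two. As 2 n^2 + 4 n + 1 = 1 + 2 n (n + 2),
  the first piece is a square and the second is q times a square.\<close>

lemma bit_vwp_term:
  "vwp_term (fps_X ^ 2) fps_X (fps_X ^ 2) n = S0_term n ^ 2 + fps_X * (S1_term n :: bit fps) ^ 2"
proof -
  define Q where "Q = (qpoch fps_X (fps_X ^ 2) n :: bit fps)"
  define R where "R = inverse (qpoch (fps_X ^ 2) (fps_X ^ 2) n :: bit fps)"
  have R: "inverse (qpoch (fps_X ^ 2) (fps_X ^ 2) n ^ 2 :: bit fps) = R ^ 2"
    by (simp add: R_def power2_eq_square fps_inverse_mult)
  have "fps_nth (qpoch (fps_X ^ 2) (fps_X ^ 2 :: bit fps) n ^ 2) 0 \<noteq> 0"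
       "fps_nth (qpoch (fps_X ^ 2) (fps_X ^ 2 :: bit fps) n) 0 \<noteq> 0"
    by (auto simp: fps_power_zeroth)
  hence "vwp_term (fps_X ^ 2) fps_X (fps_X ^ 2) n = fps_X ^ (2 * n ^ 2) * (1 + fps_X ^ (4 * n + 1)) * Q ^ 2 * R ^ 2"
        "S0_term n = fps_X ^ (n ^ 2) * Q * R" "S1_term n = fps_X ^ (n * (n + 2)) * Q * R"
    by (simp_all only: vwp_term_specialise S0_term_def S1_term_def bit_fps_uminus fps_divide_unit R bit_fps_diff not_False_eq_True Q_def R_def)
  moreover have "fps_X ^ (2 * n ^ 2) * fps_X ^ (4 * n + 1) = (fps_X * (fps_X ^ (n * (n + 2))) ^ 2 :: bit fps)"
    by (simp add: algebra_simps power2_eq_square flip: power_add power_mult power_Suc)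
  moreover have "fps_X ^ (2 * n ^ 2) = ((fps_X ^ (n ^ 2)) ^ 2 :: bit fps)"
    by (simp add: mult.commute flip: power_mult)
  ultimately show ?thesis
    by (simp only: power_mult_distrib distrib_left distrib_right mult_1_right) (simp only: mult_ac)
qed

abbreviation inv_euler_cubed :: "bit fps" where
  "inv_euler_cubed \<equiv> inverse (euler_fps 1 ^ 3)"

text \<open>Modulo 2 one has f_2 = f_1^2, so the hypothesis reads f_1^4 S = f_1, and one factor f_1
  cancels.\<close>

lemma eq_inv_euler_cubed:
  assumes "euler_fps 2 ^ 2 * S = (euler_fps 1 :: bit fps)"
  shows   "S = inv_euler_cubed"
proof -
  define e :: "bit fps" where "e = euler_fps 1"
  have e0: "fps_nth (e ^ 3) 0 = 1" "e \<noteq> 0"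
    by (auto simp: e_def fps_power_zeroth)
       (metis fps_nth_0_euler_fps fps_zero_nth zero_neq_one)
  have "euler_fps 2 = e ^ 2"
    using bit_euler_fps_square[of 1] by (simp add: e_def)
  hence "e * (e ^ 3 * S) = e * 1"
    using assms by (simp add: e_def power_mult[symmetric] power_add[symmetric] mult_ac power_numeral_reduce)
  hence "e ^ 3 * S = 1"
    using e0(2) by (simp only: mult_cancel_left) simp
  hence "inverse (e ^ 3) * (e ^ 3 * S) = inverse (e ^ 3)"
    by simp
  thus ?thesis
    using fps_inverse_mult_self(2)[OF e0(1), of S] by (simp only: e_def)
qed

lemma bit_mu2_eq: "suminf mu2_term = inv_euler_cubed"
  unfolding bit_mu2_term by (rule eq_inv_euler_cubed[OF suminf_gauss_term_eq])

lemma bit_S0_S1_eq: "suminf S0_term ^ 2 + fps_X * suminf S1_term ^ 2 = inv_euler_cubed"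
proof -
  have "(\<lambda>N. (\<Sum>n<N. S0_term n) ^ 2 + fps_X * (\<Sum>n<N. S1_term n) ^ 2) \<longlonglongrightarrow>
          suminf S0_term ^ 2 + fps_X * (suminf S1_term ^ 2 :: bit fps)"
    using suminf_fps_sums[OF mock_term_dvd(3)[where 'a = bit]]
          suminf_fps_sums[OF mock_term_dvd(4)[where 'a = bit]]
    unfolding sums_def
    by (intro tendsto_add_fps tendsto_mult_fps tendsto_power_fps tendsto_const)
  also have "(\<lambda>N. (\<Sum>n<N. S0_term n) ^ 2 + fps_X * (\<Sum>n<N. S1_term n :: bit fps) ^ 2) =
             (\<lambda>N. \<Sum>n<N. vwp_term (fps_X ^ 2) fps_X (fps_X ^ 2) n)"
    by (simp only: bit_fps_sum_square bit_vwp_term sum.distrib sum_distrib_left)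
  finally have "vwp_term (fps_X ^ 2) fps_X (fps_X ^ 2) sums (suminf S0_term ^ 2 + fps_X * (suminf S1_term ^ 2 :: bit fps))"
    by (simp only: sums_def)
  hence "suminf S0_term ^ 2 + fps_X * (suminf S1_term ^ 2 :: bit fps) = suminf (vwp_term (fps_X ^ 2) fps_X (fps_X ^ 2))"
    by (rule sums_unique)
  thus ?thesis
    using eq_inv_euler_cubed[OF suminf_vwp_term_eq] by simp
qed

text \<open>Squares over \<open>bit\<close> have only even exponents, so in
  \<open>bit_S0_S1_eq\<close> the series S_0 carries exactly the even part and S_1 the odd
  part.\<close>

lemma bit_S0_nth: "fps_nth (suminf S0_term) n = fps_nth inv_euler_cubed (2 * n)"
  unfolding bit_S0_S1_eq[symmetric] by (simp add: bit_fps_square_nth)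

lemma bit_S1_nth: "fps_nth (suminf S1_term) n = fps_nth inv_euler_cubed (2 * n + 1)"
  unfolding bit_S0_S1_eq[symmetric] by (simp add: bit_fps_square_nth)

section \<open>Reduction of integral power series\<close>

definition fps_of_int :: "int fps \<Rightarrow> 'a::comm_ring_1 fps" where
  "fps_of_int H = Abs_fps (\<lambda>n. of_int (fps_nth H n))"

lemma fps_nth_fps_of_int [simp]: "fps_nth (fps_of_int H) n = of_int (fps_nth H n)"
  by (simp add: fps_of_int_def)

lemma fps_of_int_hom:
  "fps_of_int 1 = 1" "fps_of_int fps_X = fps_X" "fps_of_int (- F) = - fps_of_int F"
  "fps_of_int (F + G) = fps_of_int F + fps_of_int G" "fps_of_int (F * G) = fps_of_int F * fps_of_int G"
  by (auto simp: fps_eq_iff fps_mult_nth fps_X_def)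

text \<open>A common integral lift records at once that \<open>F\<close> has integer coefficients
  and that \<open>f\<close> is its reduction modulo 2; \<open>icong\<close> demands both.\<close>

definition reduces :: "complex fps \<Rightarrow> bit fps \<Rightarrow> bool" where
  "reduces F f \<longleftrightarrow> (\<exists>H. F = fps_of_int H \<and> f = fps_of_int H)"

lemma reducesI: "F = fps_of_int H \<Longrightarrow> f = fps_of_int H \<Longrightarrow> reduces F f"
  by (auto simp: reduces_def)

lemma reducesE:
  assumes "reduces F f"
  obtains H where "F = fps_of_int H" "f = fps_of_int H"
  using assms by (auto simp: reduces_def)

lemma reduces_1: "reduces 1 1"
  by (rule reducesI[of _ 1]) (simp_all only: fps_of_int_hom)

lemma reduces_X: "reduces fps_X fps_X"
  by (rule reducesI[of _ fps_X]) (simp_all only: fps_of_int_hom)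

lemma reduces_uminus:
  assumes "reduces F f" shows "reduces (- F) (- f)"
  using assms unfolding reduces_def by (metis fps_of_int_hom(3))

lemma reduces_add:
  assumes "reduces F f" "reduces G g" shows "reduces (F + G) (f + g)"
  using assms unfolding reduces_def by (metis fps_of_int_hom(4))

lemma reduces_diff:
  assumes "reduces F f" "reduces G g" shows "reduces (F - G) (f - g)"
  unfolding diff_conv_add_uminus by (intro reduces_add reduces_uminus assms)

lemma reduces_mult:
  assumes "reduces F f" "reduces G g" shows "reduces (F * G) (f * g)"
  using assms unfolding reduces_def by (metis fps_of_int_hom(5))

lemma reduces_power:
  assumes "reduces F f" shows "reduces (F ^ n) (f ^ n)"
  by (induction n) (auto simp only: power_0 power_Suc intro!: reduces_1 reduces_mult assms)

lemma reduces_inverse: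
  assumes "reduces F f" "fps_nth F 0 = 1"
  shows   "reduces (inverse F) (inverse f)"
proof -
  obtain H where H: "F = fps_of_int H" "f = fps_of_int H"
    using assms(1) by (rule reducesE)
  have H0: "fps_nth H 0 = 1"
    using assms(2) by (simp add: H)
  \<comment> \<open>A series with constant term 1 is invertible over the integers; \<open>K\<close>
    maps to the inverse of \<open>F\<close> and to that of \<open>f\<close>.\<close>
  define K where "K = fps_right_inverse H 1"
  have "H * K = 1"
    unfolding K_def by (rule fps_right_inverse) (simp add: H0)
  hence "F * fps_of_int K = 1" "f * fps_of_int K = 1"
    by (simp_all only: H fps_of_int_hom(5)[symmetric]) (simp_all only: fps_of_int_hom)
  thus ?thesis
    by (intro reducesI[of _ K]) (auto intro: fps_inverse_unique)
qed

lemma reduces_nth_0: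
  assumes "reduces F f" "fps_nth F 0 = 1"
  shows   "fps_nth f 0 = 1"
  using assms by (elim reducesE) auto

lemma reduces_divide:
  assumes "reduces F f" "reduces G g" "fps_nth G 0 = 1"
  shows   "reduces (F / G) (f / g)"
proof -
  have "F / G = F * inverse G" "f / g = f * inverse g"
    using assms(3) reduces_nth_0[OF assms(2,3)] by (auto intro!: fps_divide_unit)
  thus ?thesis
    by (simp only: reduces_mult reduces_inverse assms)
qed

lemma reduces_qpoch:
  assumes "reduces A a" "reduces Q q"
  shows   "reduces (qpoch A Q n) (qpoch a q n)"
  by (induction n) (auto simp only: qpoch_0 qpoch_Suc intro!: reduces_1 reduces_mult reduces_diff reduces_power assms)

lemma reducesI_nth:
  assumes "\<And>n. \<exists>k. fps_nth F n = of_int k \<and> fps_nth f n = of_int k"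
  shows   "reduces F f"
proof -
  from assms obtain h where h: "\<And>n. fps_nth F n = of_int (h n) \<and> fps_nth f n = of_int (h n)"
    by metis
  show ?thesis
    by (rule reducesI[of _ "Abs_fps h"]) (auto simp: fps_eq_iff h)
qed

lemma reduces_nthD:
  assumes "reduces F f"
  shows   "\<exists>k. fps_nth F n = of_int k \<and> fps_nth f n = of_int k"
  using assms by (auto elim!: reducesE)

lemma reduces_euler_fps: "reduces (euler_fps k) (euler_fps k)"
  by (rule reducesI_nth)
     (unfold euler_fps_def fps_nth_Abs_fps, intro reduces_nthD reduces_qpoch reduces_power reduces_X)

lemma reduces_suminf:
  assumes red: "\<And>n. reduces (T n) (t n)" and dvd: "\<And>n. fps_X ^ n dvd T n" "\<And>n. fps_X ^ n dvd t n"
  shows   "reduces (suminf T) (suminf t)"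
proof (rule reducesI_nth)
  fix k
  from red obtain H where H: "\<And>n. T n = fps_of_int (H n)" "\<And>n. t n = fps_of_int (H n)"
    unfolding reduces_def by metis
  have "fps_nth (suminf T) k = of_int (\<Sum>n\<le>k. fps_nth (H n) k)"
    by (simp only: fps_nth_suminf[OF dvd(1)] of_int_sum) (simp add: H)
  moreover have "fps_nth (suminf t) k = of_int (\<Sum>n\<le>k. fps_nth (H n) k)"
    by (simp only: fps_nth_suminf[OF dvd(2)] of_int_sum) (simp add: H)
  ultimately show "\<exists>m. fps_nth (suminf T) k = of_int m \<and> fps_nth (suminf t) k = of_int m"
    by blast
qed

lemma reduces_mock:
  "reduces mock_mu2 (suminf mu2_term)" "reduces mock_U0 (suminf U0_term)"
  "reduces mock_S0 (suminf S0_term)" "reduces mock_S1 (suminf S1_term)"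
  unfolding mock_eq_suminf
  by (intro reduces_suminf mock_term_dvd; unfold mu2_term_def U0_term_def S0_term_def S1_term_def;
      intro reduces_divide reduces_mult reduces_power reduces_uminus reduces_qpoch reduces_1 reduces_X;
      simp add: fps_power_zeroth)+

text \<open>The indices m and n may differ, since coefficients of the hauptmoduln and of the mock
  theta functions are compared at different exponents.\<close>

lemma icong_2I:
  assumes "reduces F f" "reduces G g" "fps_nth f m = fps_nth g n"
  shows   "icong (fps_nth F m) (fps_nth G n) 2"
proof -
  obtain a b :: int where ab: "fps_nth F m = of_int a" "fps_nth f m = of_int a"
      "fps_nth G n = of_int b" "fps_nth g n = of_int b"
    using reduces_nthD[OF assms(1), of m] reduces_nthD[OF assms(2), of n] by blast
  have "(of_int k = (0 :: bit)) \<longleftrightarrow> even k" for k :: int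
    by (metis even_of_int_iff even_zero Z2.bit_eq_iff)
  moreover have "of_int (a - b) = (0 :: bit)"
    using assms(3) ab by (simp only: of_int_diff) simp
  ultimately have "even (a - b)"
    by blast
  thus ?thesis
    unfolding icong_def cong_iff_dvd_diff using ab by blast
qed

section \<open>Expansions of Euler products and of the Eisenstein series\<close>

lemma norm_nome_less_1:
  assumes "Im \<tau> > 0"
  shows   "norm (nome \<tau>) < 1"
  using assms by (simp add: nome_def)

lemma nome_nonzero [simp]: "nome \<tau> \<noteq> 0"
  by (simp add: nome_def)

text \<open>Division by the nome moves every exponent down by one, whence the index
  \<open>int n - 1\<close>. Holomorphy on the whole unit disc gives the convergence radius that
  \<open>has_q_expansion\<close> requires.\<close>

lemma fourier_coeff_eq_fps_nth:
  assumes "g holomorphic_on ball 0 1" "g has_fps_expansion F"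
  assumes "\<And>\<tau>. Im \<tau> > 0 \<Longrightarrow> f \<tau> = g (nome \<tau>) / nome \<tau>"
  shows   "fourier_coeff f (int n - 1) = fps_nth F n"
proof -
  have rad: "fps_conv_radius F \<ge> 1"
    using assms(1,2) holomorphic_on_imp_fps_conv_radius_ge[of g F 1] by (simp add: one_ereal_def)
  have "has_q_expansion f (fls_shift 1 (fps_to_fls F))"
    unfolding has_q_expansion_def
  proof (intro conjI allI impI)
    fix \<tau> assume \<tau>: "Im \<tau> > 0"
    have less: "ereal (norm (nome \<tau>)) < fps_conv_radius F"
      using norm_nome_less_1[OF \<tau>] rad by (meson ereal_less(3) less_le_trans)
    have "eval_fls (fls_shift 1 (fps_to_fls F)) (nome \<tau>) = eval_fps F (nome \<tau>) / nome \<tau>"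
      using less by (simp add: eval_fls_shift eval_fps_to_fls power_int_minus divide_inverse)
    also have "eval_fps F (nome \<tau>) = g (nome \<tau>)"
      using assms(1,2) norm_nome_less_1[OF \<tau>] by (intro has_fps_expansion_imp_eval_fps_eq[where r = 1])
    finally show "eval_fls (fls_shift 1 (fps_to_fls F)) (nome \<tau>) = f \<tau>"
      using assms(3)[OF \<tau>] by simp
  qed (use rad in simp)
  thus ?thesis
    by (simp add: fourier_coeff_eqI)
qed

section \<open>Euler products as holomorphic functions on the unit disc\<close>

definition euler_fun :: "nat \<Rightarrow> complex \<Rightarrow> complex" where
  "euler_fun k z = qpoch_inf (z ^ k) (z ^ k)"

context
  fixes k :: nat
  assumes k: "k > 0"
begin

lemma norm_euler_factor_le:
  assumes "norm z \<le> r" "r < (1::real)"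
  shows   "norm ((z::complex) ^ k * (z ^ k) ^ n) \<le> r ^ n"
proof -
  have "norm (z ^ k * (z ^ k) ^ n) = norm z ^ (k * Suc n)"
    by (simp add: norm_mult norm_power power_mult power_add)
  also have "\<dots> \<le> norm z ^ n"
  proof (rule power_decreasing)
    show "n \<le> k * Suc n"
      using k by (cases k) auto
  qed (use assms in auto)
  also have "\<dots> \<le> r ^ n"
    using assms by (intro power_mono) auto
  finally show ?thesis .
qed

lemma convergent_prod_euler:
  assumes "norm z < 1"
  shows   "convergent_prod (\<lambda>n. 1 - (z::complex) ^ k * (z ^ k) ^ n)"
proof (rule abs_convergent_prod_imp_convergent_prod, rule summable_imp_abs_convergent_prod)
  have "summable (\<lambda>n. norm z ^ n)"
    using assms by (intro summable_geometric) auto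
  thus "summable (\<lambda>n. norm ((1 - z ^ k * (z ^ k) ^ n) - 1))"
    by (rule summable_comparison_test'[where N = 0])
       (use norm_euler_factor_le[of z "norm z"] assms in auto)
qed

lemma euler_factor_nonzero:
  assumes "norm z < 1"
  shows   "1 - (z::complex) ^ k * (z ^ k) ^ n \<noteq> 0"
proof
  assume "1 - z ^ k * (z ^ k) ^ n = 0"
  moreover have "z ^ (k * Suc n) = z ^ k * (z ^ k) ^ n"
    by (simp only: power_mult power_Suc)
  ultimately have "z ^ (k * Suc n) = 1"
    by simp
  hence "norm z ^ (k * Suc n) = 1"
    by (metis norm_one norm_power)
  moreover have "norm z ^ (k * Suc n) < 1"
    using assms k by (subst power_less_one_iff) auto
  ultimately show False by simp
qed

lemma euler_fun_nonzero:
  assumes "norm z < 1"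
  shows   "euler_fun k z \<noteq> 0"
  unfolding euler_fun_def qpoch_inf_def
  using convergent_prod_euler[OF assms] euler_factor_nonzero[OF assms] by (rule prodinf_nonzero)

lemma uniform_limit_euler_fun:
  assumes "0 \<le> r" "r < 1"
  shows   "uniform_limit (cball 0 r) (\<lambda>N z. qpoch (z ^ k) (z ^ k) N) (euler_fun k) sequentially"
proof -
  let ?f = "\<lambda>n z. 1 - z ^ k * (z ^ k) ^ n :: complex"
  have "uniformly_convergent_on (cball 0 r) (\<lambda>N z. \<Prod>n<N. ?f n z)"
  proof (rule uniformly_convergent_on_prod')
    show "continuous_on (cball 0 r) (?f n)" for n
      by (intro continuous_intros)
    show "uniformly_convergent_on (cball 0 r) (\<lambda>N z. \<Sum>n<N. norm (?f n z - 1))"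
    proof (rule Weierstrass_m_test')
      show "norm (norm (?f n z - 1)) \<le> r ^ n" if "z \<in> cball 0 r" for n z
        using norm_euler_factor_le[of z r n] that assms by auto
      show "summable (\<lambda>n. r ^ n)"
        using assms by (intro summable_geometric) auto
    qed
  qed auto
  hence "uniform_limit (cball 0 r) (\<lambda>N z. \<Prod>n<N. ?f n z) (\<lambda>z. lim (\<lambda>N. \<Prod>n<N. ?f n z)) sequentially"
    by (simp add: uniformly_convergent_uniform_limit_iff)
  also have "?this \<longleftrightarrow> ?thesis"
  proof (rule uniform_limit_cong')
    fix z :: complex assume "z \<in> cball 0 r"
    hence "norm z < 1" using assms by auto
    thus "lim (\<lambda>N. \<Prod>n<N. ?f n z) = euler_fun k z"
      unfolding euler_fun_def qpoch_inf_def
      by (intro prodinf_eq_lim'[symmetric] convergent_prod_euler euler_factor_nonzero)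
  qed (simp add: qpoch_def)
  finally show ?thesis .
qed

lemma holomorphic_euler_fun: "euler_fun k holomorphic_on ball 0 1"
proof (rule holomorphic_uniform_sequence)
  show "(\<lambda>z. qpoch (z ^ k) (z ^ k) N) holomorphic_on ball 0 1" for N
    unfolding qpoch_def by (intro holomorphic_intros)
  fix z :: complex assume z: "z \<in> ball 0 1"
  \<comment> \<open>Half the distance from z to the unit circle keeps the closed disc around z
    inside a centred closed disc of radius below 1.\<close>
  define d where "d = (1 - norm z) / 2"
  have d: "d > 0" "norm z + d < 1"
    using z by (auto simp: d_def field_simps)
  have subset: "cball z d \<subseteq> cball 0 (norm z + d)"
    by (subst cball_subset_cball_iff) (auto simp: dist_norm)
  show "\<exists>d>0. cball z d \<subseteq> ball 0 1 \<and>
          uniform_limit (cball z d) (\<lambda>N z. qpoch (z ^ k) (z ^ k) N) (euler_fun k) sequentially"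
    using d uniform_limit_on_subset[OF uniform_limit_euler_fun[OF _ d(2)] subset] subset
    by (intro exI[of _ d]) auto
qed auto

lemma has_fps_expansion_qpoch:
  "(\<lambda>z. qpoch (z ^ k) (z ^ k) N) has_fps_expansion (qpoch (fps_X ^ k) (fps_X ^ k) N :: complex fps)"
  unfolding qpoch_def by (intro fps_expansion_intros)

text \<open>The partial products converge uniformly near 0 and, as power series, coefficient by
  coefficient; the two limits must correspond.\<close>

lemma has_fps_expansion_euler_fun: "euler_fun k has_fps_expansion euler_fps k"
proof -
  have "euler_fun k analytic_on {0}"
    using holomorphic_euler_fun by (rule holomorphic_on_imp_analytic_at) auto
  hence *: "euler_fun k has_fps_expansion fps_expansion (euler_fun k) 0"
    by (rule analytic_at_imp_has_fps_expansion_0)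
  have "fps_expansion (euler_fun k) 0 = euler_fps k"
  proof (rule uniform_limit_imp_fps_expansion_eq[OF qpoch_tendsto_euler_fps[OF k] _ _ *])
    show "uniform_limit (ball 0 (1/2)) (\<lambda>N z. qpoch (z ^ k) (z ^ k) N) (euler_fun k) sequentially"
      by (rule uniform_limit_on_subset[OF uniform_limit_euler_fun[of "1/2"]]) auto
    show "eventually (\<lambda>N. (\<lambda>z::complex. qpoch (z ^ k) (z ^ k) N) holomorphic_on ball 0 (1/2)) sequentially"
      unfolding qpoch_def by (intro always_eventually allI holomorphic_intros)
  qed (auto intro!: always_eventually has_fps_expansion_qpoch)
  with * show ?thesis by simp
qed

end

lemmas euler_fun_facts = euler_fun_nonzero holomorphic_euler_fun has_fps_expansion_euler_fun

text \<open>All branches of q^(k/24) are powers of one fixed 24th root of the nome, so prefactors of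
  eta quotients combine by adding exponents.\<close>

lemma eta_mult_eq: "eta_mult k \<tau> = exp (2 * of_real pi * \<i> * \<tau> / 24) ^ k * euler_fun k (nome \<tau>)"
proof -
  have "nome (of_nat k * \<tau>) = nome \<tau> ^ k"
    by (simp add: nome_def mult_ac flip: exp_of_nat_mult)
  thus ?thesis
    by (simp add: eta_mult_def eta_def euler_fun_def mult_ac flip: exp_of_nat_mult)
qed

lemma nome_eq_power: "nome \<tau> = exp (2 * of_real pi * \<i> * \<tau> / 24) ^ 24"
  by (simp add: nome_def mult_ac flip: exp_of_nat_mult)

lemma modular_discr_eq:
  assumes "Im \<tau> > 0"
  shows   "modular_discr \<tau> = nome \<tau> * euler_fun 1 (nome \<tau>) ^ 24"
  using convergent_prod_euler[of 1 "nome \<tau>"] norm_nome_less_1[OF assms]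
  by (simp add: modular_discr_def euler_fun_def qpoch_inf_def prodinf_power)

section \<open>Divisor sums and the series E_4\<close>

lemma divisor_sum_3_le:
  assumes "n > 0"
  shows   "divisor_sum 3 n \<le> n ^ 4"
proof -
  have "{d. d dvd n} \<subseteq> {1..n}"
    using assms by (auto simp: dvd_imp_le Suc_le_eq intro!: Nat.gr0I)
  hence "card {d. d dvd n} \<le> card {1..n}"
    by (intro card_mono) auto
  have "divisor_sum 3 n \<le> (\<Sum>d | d dvd n. n ^ 3)"
    unfolding divisor_sum_def using assms by (intro sum_mono power_mono) (auto intro: dvd_imp_le)
  also have "\<dots> = card {d. d dvd n} * n ^ 3"
    by simp
  also have "\<dots> \<le> n * n ^ 3"
    using \<open>card {d. d dvd n} \<le> card {1..n}\<close> by (intro mult_right_mono) auto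
  finally show ?thesis
    by (simp add: power_numeral_reduce)
qed

lemma summable_divisor_sum_3:
  fixes z :: complex
  assumes "norm z < 1"
  shows   "summable (\<lambda>n. of_nat (divisor_sum 3 (Suc n)) * z ^ Suc n)"
proof (rule summable_comparison_test)
  \<comment> \<open>A radius strictly between \<open>norm z\<close> and 1, positive even for z = 0,
    so that n^4 r^n is eventually below 1 / n^2.\<close>
  define r where "r = (norm z + 1) / 2"
  have r: "norm z < r" "0 < r" "r < 1"
    using assms by (auto simp: r_def add_nonneg_pos)
  show "summable (\<lambda>n. 1 / real (Suc n) ^ 2)"
    by (subst summable_Suc_iff[where f = "\<lambda>n. 1 / real n ^ 2"]) (use inverse_power_summable[of 2, where 'a = real] in \<open>simp add: field_simps\<close>)
  have "eventually (\<lambda>n. real (Suc n) ^ 4 * r ^ Suc n \<le> 1 / real (Suc n) ^ 2) at_top"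
    using r(2,3) by real_asymp
  hence "eventually (\<lambda>n. norm (of_nat (divisor_sum 3 (Suc n)) * z ^ Suc n) \<le> 1 / real (Suc n) ^ 2) at_top"
  proof eventually_elim
    case (elim n)
    have "norm (of_nat (divisor_sum 3 (Suc n)) * z ^ Suc n) = real (divisor_sum 3 (Suc n)) * norm z ^ Suc n"
      by (simp add: norm_mult norm_power)
    also have "\<dots> \<le> real (Suc n ^ 4) * r ^ Suc n"
      using divisor_sum_3_le[of "Suc n"] r by (intro mult_mono power_mono of_nat_mono) auto
    also have "\<dots> \<le> 1 / real (Suc n) ^ 2"
      using elim by simp
    finally show ?case .
  qed
  thus "\<exists>N. \<forall>n\<ge>N. norm (of_nat (divisor_sum 3 (Suc n)) * z ^ Suc n) \<le> 1 / real (Suc n) ^ 2"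
    by (simp only: eventually_sequentially)
qed

definition sigma3_fps :: "complex fps" where
  "sigma3_fps = Abs_fps (\<lambda>n. if n = 0 then 0 else of_nat (divisor_sum 3 n))"

lemma sums_sigma3_fps:
  fixes z :: complex
  assumes "norm z < 1"
  shows   "(\<lambda>n. fps_nth sigma3_fps n * z ^ n) sums (\<Sum>n. of_nat (divisor_sum 3 (Suc n)) * z ^ Suc n)"
proof -
  have "(\<lambda>n. fps_nth sigma3_fps (Suc n) * z ^ Suc n) sums (\<Sum>n. of_nat (divisor_sum 3 (Suc n)) * z ^ Suc n)"
    using summable_sums[OF summable_divisor_sum_3[OF assms]] by (simp add: sigma3_fps_def)
  thus ?thesis
    by (subst (asm) sums_Suc_iff) (simp add: sigma3_fps_def)
qed

definition E4_fun :: "complex \<Rightarrow> complex" where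
  "E4_fun z = 1 + 240 * eval_fps sigma3_fps z"

lemma Eisenstein_E4_eq:
  assumes "Im \<tau> > 0"
  shows   "Eisenstein_E4 \<tau> = E4_fun (nome \<tau>)"
  using sums_sigma3_fps[OF norm_nome_less_1[OF assms]]
  by (simp add: Eisenstein_E4_def E4_fun_def eval_fps_def sums_iff)

lemma fps_conv_radius_sigma3_fps: "fps_conv_radius sigma3_fps \<ge> 1"
  unfolding fps_conv_radius_def one_ereal_def
proof (rule conv_radius_geI_ex)
  fix r :: real assume r: "0 < r" "ereal r < ereal 1"
  thus "\<exists>z. norm z = r \<and> summable (\<lambda>n. fps_nth sigma3_fps n * z ^ n)"
    using sums_sigma3_fps[of "of_real r"] by (intro exI[of _ "of_real r"]) (auto simp: sums_iff)
qed

lemma holomorphic_E4_fun: "E4_fun holomorphic_on ball 0 1"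
proof -
  have "ball 0 1 \<subseteq> eball (0::complex) (fps_conv_radius sigma3_fps)"
    using fps_conv_radius_sigma3_fps by (intro ball_eball_mono) (simp add: one_ereal_def)
  thus ?thesis
    unfolding E4_fun_def by (intro holomorphic_intros)
qed

lemma has_fps_expansion_E4_fun: "E4_fun has_fps_expansion (1 + 240 * sigma3_fps)"
proof -
  have "fps_conv_radius sigma3_fps > 0"
    using fps_conv_radius_sigma3_fps by (rule less_le_trans[rotated]) auto
  thus ?thesis
    unfolding E4_fun_def by (intro fps_expansion_intros eval_fps_has_fps_expansion)
qed

text \<open>The constant 240 is even.\<close>

lemma reduces_E4_fps: "reduces (1 + 240 * sigma3_fps) 1"
proof (rule reducesI_nth)
  fix n
  show "\<exists>k. fps_nth (1 + 240 * sigma3_fps) n = of_int k \<and> fps_nth 1 n = (of_int k :: bit)"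
    by (cases "n = 0")
       (auto simp: sigma3_fps_def intro!: exI[of _ 1] exI[of _ "240 * int (divisor_sum 3 n)"])
qed

section \<open>The hauptmoduln modulo 2\<close>

text \<open>The reduction of q j_N for all five levels; the form as an eighth power is what
  \<open>bit_fps_power8_nth\<close> needs.\<close>

definition inv_euler24 :: "bit fps" where
  "inv_euler24 = inv_euler_cubed ^ 8"

lemma fourier_coeff_reduces:
  assumes "g holomorphic_on ball 0 1" "g has_fps_expansion F"
  assumes "\<And>\<tau>. Im \<tau> > 0 \<Longrightarrow> f \<tau> = g (nome \<tau>) / nome \<tau>"
  assumes "reduces F inv_euler24"
  shows   "\<exists>F. (\<forall>n. fourier_coeff f (int n - 1) = fps_nth F n) \<and> reduces F inv_euler24"
  using fourier_coeff_eq_fps_nth[OF assms(1-3)] assms(4) by blast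

lemma bit_fps_divide_eqI:
  assumes "f = e ^ m" "g = e ^ (m + 24)" "e = (euler_fps 1 :: bit fps)"
  shows   "f / g = inv_euler24"
proof -
  have e0: "fps_nth (e ^ n) 0 = 1" for n
    using assms(3) by (simp add: fps_power_zeroth)
  have "f / g = e ^ m * inverse (e ^ m * e ^ 24)"
    unfolding assms(1,2) power_add[symmetric] by (rule fps_divide_unit) (simp add: e0)
  also have "\<dots> = inverse (e ^ 24) * (inverse (e ^ m) * e ^ m)"
    by (simp only: fps_inverse_mult mult_ac)
  also have "\<dots> = inverse ((e ^ 3) ^ 8)"
    by (simp add: fps_inverse_mult_self e0 flip: power_mult)
  also have "\<dots> = inv_euler24"
    by (simp add: inv_euler24_def assms(3) fps_inverse_power)
  finally show ?thesis .
qed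

lemma j1_expansion: "\<exists>F. (\<forall>n. fourier_coeff j1 (int n - 1) = fps_nth F n) \<and> reduces F inv_euler24"
proof (rule fourier_coeff_reduces)
  show "(\<lambda>z. E4_fun z ^ 3 / euler_fun 1 z ^ 24) holomorphic_on ball 0 1"
    by (intro holomorphic_intros holomorphic_E4_fun euler_fun_facts) (auto simp: euler_fun_facts)
  show "(\<lambda>z. E4_fun z ^ 3 / euler_fun 1 z ^ 24) has_fps_expansion (1 + 240 * sigma3_fps) ^ 3 / euler_fps 1 ^ 24"
    by (intro fps_expansion_intros has_fps_expansion_E4_fun euler_fun_facts) (auto simp: fps_power_zeroth)
  show "j1 \<tau> = E4_fun (nome \<tau>) ^ 3 / euler_fun 1 (nome \<tau>) ^ 24 / nome \<tau>" if "Im \<tau> > 0" for \<tau>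
    using that by (simp add: j1_def Eisenstein_E4_eq modular_discr_eq)
  have "reduces ((1 + 240 * sigma3_fps) ^ 3 / euler_fps 1 ^ 24) (1 ^ 3 / euler_fps 1 ^ 24)"
    by (intro reduces_divide reduces_power reduces_E4_fps reduces_euler_fps) (auto simp: fps_power_zeroth)
  also have "1 ^ 3 / euler_fps 1 ^ 24 = inv_euler24"
    by (rule bit_fps_divide_eqI[where m = 0]) auto
  finally show "reduces ((1 + 240 * sigma3_fps) ^ 3 / euler_fps 1 ^ 24) inv_euler24" .
qed

text \<open>The condition \<open>exps\<close> is used twice: it makes the prefactor exactly 1/q, and
  modulo 2, where f at level 2^i is f_1^(2^i), it makes the product of Euler factors exactly
  f_1^(-24).\<close>

lemma eta_quotient_expansion:
  assumes f: "\<And>\<tau>. f \<tau> = eta_mult 1 \<tau> ^ a * eta_mult (2 ^ i) \<tau> ^ b /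
                          (eta_mult (2 ^ j) \<tau> ^ c * eta_mult (2 ^ k) \<tau> ^ d)"
  assumes exps: "2 ^ j * c + 2 ^ k * d = a + 2 ^ i * b + 24"
  shows "\<exists>F. (\<forall>n. fourier_coeff f (int n - 1) = fps_nth F n) \<and> reduces F inv_euler24"
proof (rule fourier_coeff_reduces)
  let ?g = "\<lambda>z. euler_fun 1 z ^ a * euler_fun (2 ^ i) z ^ b /
                  (euler_fun (2 ^ j) z ^ c * euler_fun (2 ^ k) z ^ d)"
  let ?G = "euler_fps 1 ^ a * euler_fps (2 ^ i) ^ b / (euler_fps (2 ^ j) ^ c * euler_fps (2 ^ k) ^ d)"
  show "?g holomorphic_on ball 0 1"
    by (intro holomorphic_intros euler_fun_facts) (auto simp: euler_fun_nonzero)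
  show "?g has_fps_expansion ?G"
    by (intro fps_expansion_intros euler_fun_facts) (auto simp: fps_power_zeroth fps_mult_nth_0)
  show "f \<tau> = ?g (nome \<tau>) / nome \<tau>" for \<tau>
  proof -
    define e where "e = exp (2 * of_real pi * \<i> * \<tau> / 24)"
    have cancel: "e ^ p * x / (e ^ (p + 24) * y) = x / y / e ^ 24" for p x y
      by (simp add: e_def power_add)
    have "f \<tau> = e ^ (a + 2 ^ i * b) * (euler_fun 1 (nome \<tau>) ^ a * euler_fun (2 ^ i) (nome \<tau>) ^ b) /
            (e ^ (2 ^ j * c + 2 ^ k * d) * (euler_fun (2 ^ j) (nome \<tau>) ^ c * euler_fun (2 ^ k) (nome \<tau>) ^ d))"
      unfolding f eta_mult_eq e_def[symmetric] power_add power_mult power_mult_distrib power_one_right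
      by (simp only: mult_ac)
    thus ?thesis
      unfolding exps cancel by (simp only: e_def nome_eq_power[symmetric])
  qed
  have "reduces ?G ?G"
    by (intro reduces_divide reduces_mult reduces_power reduces_euler_fps)
       (auto simp: fps_power_zeroth fps_mult_nth_0)
  also have "?G = inv_euler24"
  proof (rule bit_fps_divide_eqI)
    show "euler_fps 1 ^ a * euler_fps (2 ^ i) ^ b = (euler_fps 1 :: bit fps) ^ (a + 2 ^ i * b)"
      by (simp only: bit_euler_fps_power_of_2[of i] power_add power_mult)
    show "euler_fps (2 ^ j) ^ c * euler_fps (2 ^ k) ^ d = (euler_fps 1 :: bit fps) ^ (a + 2 ^ i * b + 24)"
      by (simp only: exps[symmetric] bit_euler_fps_power_of_2[of j] bit_euler_fps_power_of_2[of k]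
            power_add power_mult)
  qed auto
  finally show "reduces ?G inv_euler24" .
qed

lemma hauptmodul_expansions:
  "\<exists>F. (\<forall>n. fourier_coeff j2 (int n - 1) = fps_nth F n) \<and> reduces F inv_euler24"
  "\<exists>F. (\<forall>n. fourier_coeff j4 (int n - 1) = fps_nth F n) \<and> reduces F inv_euler24"
  "\<exists>F. (\<forall>n. fourier_coeff j8 (int n - 1) = fps_nth F n) \<and> reduces F inv_euler24"
  "\<exists>F. (\<forall>n. fourier_coeff j16 (int n - 1) = fps_nth F n) \<and> reduces F inv_euler24"
proof -
  show "\<exists>F. (\<forall>n. fourier_coeff j2 (int n - 1) = fps_nth F n) \<and> reduces F inv_euler24"
    \<comment> \<open>The arguments are a, i, b, j, c, k, d in this order; an exponent 0 marks an
      absent eta factor.\<close>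
    by (rule eta_quotient_expansion[of _ 24 0 0 0 0 1 24]) (simp_all add: j2_def)
  show "\<exists>F. (\<forall>n. fourier_coeff j4 (int n - 1) = fps_nth F n) \<and> reduces F inv_euler24"
    by (rule eta_quotient_expansion[of _ 8 0 0 0 0 2 8]) (simp_all add: j4_def)
  show "\<exists>F. (\<forall>n. fourier_coeff j8 (int n - 1) = fps_nth F n) \<and> reduces F inv_euler24"
    by (rule eta_quotient_expansion[of _ 4 2 2 1 2 3 4]) (simp_all add: j8_def)
  show "\<exists>F. (\<forall>n. fourier_coeff j16 (int n - 1) = fps_nth F n) \<and> reduces F inv_euler24"
    by (rule eta_quotient_expansion[of _ 2 3 1 1 1 4 2]) (simp_all add: j16_def)
qed

lemma inv_euler24_nth:
  "fps_nth inv_euler24 n = (if 8 dvd n then fps_nth inv_euler_cubed (n div 8) else 0)"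
  by (simp only: inv_euler24_def bit_fps_power8_nth)

theorem theorem1p1:
  shows "(\<forall>n::nat. n \<ge> 1 \<longrightarrow>
            icong (fourier_coeff j1 (int n)) (fourier_coeff j2 (int n)) 2 \<and>
            icong (fourier_coeff j2 (int n)) (fourier_coeff j4 (int n)) 2 \<and>
            icong (fourier_coeff j4 (int n)) (fourier_coeff j8 (int n)) 2 \<and>
            icong (fourier_coeff j8 (int n)) (fourier_coeff j16 (int n)) 2)
       \<and> (\<forall>n::nat. n \<ge> 1 \<and> \<not> [n = 7] (mod 8) \<longrightarrow> icong (fourier_coeff j1 (int n)) 0 2)
       \<and> (\<forall>n::nat. n \<ge> 1 \<longrightarrow>
            icong (fourier_coeff j1 (8 * int n - 1)) (fps_nth mock_mu2 n) 2 \<and>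
            icong (fps_nth mock_mu2 n) (fps_nth mock_U0 n) 2)
       \<and> (\<forall>n::nat. n \<ge> 1 \<longrightarrow>
            icong (fourier_coeff j1 (16 * int n - 1)) (fps_nth mock_S0 n) 2)
       \<and> (\<forall>n::nat. icong (fourier_coeff j1 (16 * int n + 7)) (fps_nth mock_S1 n) 2)"
proof -
  obtain F1 F2 F4 F8 F16 where F:
    "\<And>n. fourier_coeff j1 (int n - 1) = fps_nth F1 n" "\<And>n. fourier_coeff j2 (int n - 1) = fps_nth F2 n"
    "\<And>n. fourier_coeff j4 (int n - 1) = fps_nth F4 n" "\<And>n. fourier_coeff j8 (int n - 1) = fps_nth F8 n"
    "\<And>n. fourier_coeff j16 (int n - 1) = fps_nth F16 n"
    and red: "reduces F1 inv_euler24" "reduces F2 inv_euler24" "reduces F4 inv_euler24"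
      "reduces F8 inv_euler24" "reduces F16 inv_euler24"
    using j1_expansion hauptmodul_expansions by auto
  have F': "fourier_coeff j1 (int n) = fps_nth F1 (n + 1)" "fourier_coeff j2 (int n) = fps_nth F2 (n + 1)"
    "fourier_coeff j4 (int n) = fps_nth F4 (n + 1)" "fourier_coeff j8 (int n) = fps_nth F8 (n + 1)"
    "fourier_coeff j16 (int n) = fps_nth F16 (n + 1)" for n
    using F[of "n + 1"] by simp_all
  have reduces_0: "reduces 0 0"
    by (rule reducesI[of _ 0]) (simp_all add: fps_eq_iff)
  show ?thesis
  proof (intro conjI allI impI)
    fix n :: nat
    show "icong (fourier_coeff j1 (int n)) (fourier_coeff j2 (int n)) 2"
         "icong (fourier_coeff j2 (int n)) (fourier_coeff j4 (int n)) 2"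
         "icong (fourier_coeff j4 (int n)) (fourier_coeff j8 (int n)) 2"
         "icong (fourier_coeff j8 (int n)) (fourier_coeff j16 (int n)) 2"
      unfolding F' by (rule icong_2I red refl)+
  next
    fix n :: nat assume n: "n \<ge> 1 \<and> \<not> [n = 7] (mod 8)"
    \<comment> \<open>Coefficient n of j_1 sits at index n + 1, and \<open>inv_euler24\<close> is
      supported on multiples of 8.\<close>
    have "\<not> 8 dvd n + 1"
      using n unfolding cong_def by presburger
    hence "icong (fps_nth F1 (n + 1)) (fps_nth 0 0) 2"
      by (intro icong_2I[OF red(1) reduces_0]) (simp add: inv_euler24_nth)
    thus "icong (fourier_coeff j1 (int n)) 0 2"
      unfolding F' by simp
  next
    fix n :: nat
    have "icong (fps_nth F1 (8 * n)) (fps_nth mock_mu2 n) 2"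
      by (rule icong_2I[OF red(1) reduces_mock(1)]) (simp add: inv_euler24_nth bit_mu2_eq)
    thus "icong (fourier_coeff j1 (8 * int n - 1)) (fps_nth mock_mu2 n) 2"
      using F(1)[of "8 * n"] by simp
    show "icong (fps_nth mock_mu2 n) (fps_nth mock_U0 n) 2"
      by (rule icong_2I[OF reduces_mock(1,2)]) (simp only: bit_U0_term)
  next
    fix n :: nat
    \<comment> \<open>Exponent 16n - 1 corresponds to index 16n, hence to the even index 2n of
      \<open>inv_euler_cubed\<close>.\<close>
    have "16 * n div 8 = 2 * n" "8 dvd 16 * n"
      by presburger+
    hence "icong (fps_nth F1 (16 * n)) (fps_nth mock_S0 n) 2"
      by (intro icong_2I[OF red(1) reduces_mock(3)]) (simp only: inv_euler24_nth bit_S0_nth if_True)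
    thus "icong (fourier_coeff j1 (16 * int n - 1)) (fps_nth mock_S0 n) 2"
      using F(1)[of "16 * n"] by simp
  next
    fix n :: nat
    \<comment> \<open>Exponent 16n + 7 corresponds to index 16n + 8, hence to the odd index 2n +
      1.\<close>
    have "(16 * n + 8) div 8 = 2 * n + 1" "8 dvd 16 * n + 8"
      by presburger+
    hence "icong (fps_nth F1 (16 * n + 8)) (fps_nth mock_S1 n) 2"
      by (intro icong_2I[OF red(1) reduces_mock(4)]) (simp only: inv_euler24_nth bit_S1_nth if_True)
    thus "icong (fourier_coeff j1 (16 * int n + 7)) (fps_nth mock_S1 n) 2"
      using F(1)[of "16 * n + 8"] by (simp add: algebra_simps)
  qed
qed

end
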